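(* Let $R$ be a ring and let $\mathcal{L}$ be the full subcategory of $\mathrm{Mod}\text{-}R$ whose objects are all right $R$-modules with a local endomorphism ring. Let $\mu_{M_k}\colon M_{0,k}\to M_{1,k}$, for $k=1,\dots,r$, and $\mu_{N_\ell}\colon N_{0,\ell}\to N_{1,\ell}$, for $\ell=1,\dots,s$, be $r+s$ objects of the category $\mathrm{Morph}(\mathcal{L})$. Then $\bigoplus_{k=1}^r M_k\cong\bigoplus_{\ell=1}^s N_\ell$ in the category $\mathrm{Morph}(\mathrm{Mod}\text{-}R)$ if and only if $r=s$ and there exist two permutations $\varphi_d,\varphi_c$ of $\{1,2,\dots,r\}$ such that $[M_k]_d=[N_{\varphi_d(k)}]_d$ and $[M_k]_c=[N_{\varphi_c(k)}]_c$ for every $k=1,\dots,r$.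
   Context: Rings are associative with identity $1\neq 0$. $\mathrm{Morph}(\mathrm{Mod}\text{-}R)$ is the category whose objects are the right $R$-module homomorphisms; an object $M$ is a homomorphism $\mu_M\colon M_0\to M_1$. A morphism $u\colon M\to N$ is a pair $(u_0,u_1)$ of right $R$-module homomorphisms $u_0\colon M_0\to N_0$, $u_1\colon M_1\to N_1$ with $u_1\mu_M=\mu_N u_0$; composition and addition are componentwise. Direct sums of objects are formed componentwise: $\bigoplus_k M_k$ is the homomorphism $\bigoplus_k M_{0,k}\to\bigoplus_k M_{1,k}$ induced by the $\mu_{M_k}$. $\mathrm{Morph}(\mathcal{L})$ is the full subcategory of $\mathrm{Morph}(\mathrm{Mod}\text{-}R)$ whose objects are the homomorphisms $\mu_M\colon M_0\to M_1$ with both $M_0$ and $M_1$ in $\mathcal{L}$. Two objects $M,N$ of $\mathrm{Morph}(\mathrm{Mod}\text{-}R)$ belong to the same domain class, written $[M]_d=[N]_d$, if there exist morphisms $u\colon M\to N$ and $u'\colon N\to M$ in $\mathrm{Morph}(\mathrm{Mod}\text{-}R)$ such that $u_0\colon M_0\to N_0$ and $u'_0\colon N_0\to M_0$ are isomorphisms. They belong to the same codomain class, written $[M]_c=[N]_c$, if there exist morphisms $u\colon M\to N$ and $u'\colon N\to M$ such that $u_1\colon M_1\to N_1$ and $u'_1\colon N_1\to M_1$ are isomorphisms. *)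

theory Defs
  imports "HOL-Algebra.Ideal" "HOL-Combinatorics.Permutations"
begin

section \<open>Right modules\<close>

text \<open>The theory \<open>HOL-Algebra.Module\<close> only treats modules over commutative rings.  As there,
  the \<open>monoid.mult\<close> and \<open>one\<close> fields inherited from \<open>ring\<close> play no role.\<close>

record ('r, 'm) rmodule = "'m ring" +
  ract :: "'m \<Rightarrow> 'r \<Rightarrow> 'm" (infixl "\<lhd>\<index>" 70)

locale right_module = R?: ring R + M?: abelian_group M
  for R :: "'r ring" (structure) and M :: "('r, 'm) rmodule" (structure) +
  assumes ract_closed: "\<lbrakk>x \<in> carrier M; a \<in> carrier R\<rbrakk> \<Longrightarrow> x \<lhd>\<^bsub>M\<^esub> a \<in> carrier M"
    and ract_add_ring: "\<lbrakk>x \<in> carrier M; a \<in> carrier R; b \<in> carrier R\<rbrakk> \<Longrightarrow>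
      x \<lhd>\<^bsub>M\<^esub> (a \<oplus>\<^bsub>R\<^esub> b) = x \<lhd>\<^bsub>M\<^esub> a \<oplus>\<^bsub>M\<^esub> x \<lhd>\<^bsub>M\<^esub> b"
    and ract_add_module: "\<lbrakk>x \<in> carrier M; y \<in> carrier M; a \<in> carrier R\<rbrakk> \<Longrightarrow>
      (x \<oplus>\<^bsub>M\<^esub> y) \<lhd>\<^bsub>M\<^esub> a = x \<lhd>\<^bsub>M\<^esub> a \<oplus>\<^bsub>M\<^esub> y \<lhd>\<^bsub>M\<^esub> a"
    and ract_mult: "\<lbrakk>x \<in> carrier M; a \<in> carrier R; b \<in> carrier R\<rbrakk> \<Longrightarrow>
      x \<lhd>\<^bsub>M\<^esub> (a \<otimes>\<^bsub>R\<^esub> b) = (x \<lhd>\<^bsub>M\<^esub> a) \<lhd>\<^bsub>M\<^esub> b"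
    and ract_one: "x \<in> carrier M \<Longrightarrow> x \<lhd>\<^bsub>M\<^esub> \<one>\<^bsub>R\<^esub> = x"

text \<open>Homomorphisms are extensional, so that equality of homomorphisms is equality of HOL
  functions; they are composed with \<^const>\<open>compose\<close>.\<close>

definition rmod_hom ::
    "'r ring \<Rightarrow> ('r, 'a) rmodule \<Rightarrow> ('r, 'b) rmodule \<Rightarrow> ('a \<Rightarrow> 'b) set" where
  "rmod_hom R M N = {f \<in> carrier M \<rightarrow>\<^sub>E carrier N.
     (\<forall>x\<in>carrier M. \<forall>y\<in>carrier M. f (x \<oplus>\<^bsub>M\<^esub> y) = f x \<oplus>\<^bsub>N\<^esub> f y) \<and>
     (\<forall>x\<in>carrier M. \<forall>a\<in>carrier R. f (x \<lhd>\<^bsub>M\<^esub> a) = f x \<lhd>\<^bsub>N\<^esub> a)}"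

definition rmod_iso ::
    "'r ring \<Rightarrow> ('r, 'a) rmodule \<Rightarrow> ('r, 'b) rmodule \<Rightarrow> ('a \<Rightarrow> 'b) set" where
  "rmod_iso R M N = {f \<in> rmod_hom R M N. bij_betw f (carrier M) (carrier N)}"

definition endo_ring :: "'r ring \<Rightarrow> ('r, 'a) rmodule \<Rightarrow> ('a \<Rightarrow> 'a) ring" where
  "endo_ring R M = \<lparr>carrier = rmod_hom R M M,
     monoid.mult = compose (carrier M),
     one = (\<lambda>x\<in>carrier M. x),
     zero = (\<lambda>x\<in>carrier M. \<zero>\<^bsub>M\<^esub>),
     add = (\<lambda>f g. \<lambda>x\<in>carrier M. f x \<oplus>\<^bsub>M\<^esub> g x)\<rparr>"

text \<open>A (not necessarily commutative) ring is local if its non-units form a two-sided ideal.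
  In the zero ring \<open>\<zero>\<close> is a unit, so the zero ring is not local.\<close>

definition local_ring :: "('a, 'b) ring_scheme \<Rightarrow> bool" where
  "local_ring S \<longleftrightarrow> ring S \<and> ideal (carrier S - Units S) S"

definition local_endo_modules :: "'r ring \<Rightarrow> ('r, 'm) rmodule set" where
  "local_endo_modules R = {M. right_module R M \<and> local_ring (endo_ring R M)}"

definition rmod_sum :: "'i set \<Rightarrow> ('i \<Rightarrow> ('r, 'm) rmodule) \<Rightarrow> ('r, 'i \<Rightarrow> 'm) rmodule" where
  "rmod_sum I M = \<lparr>carrier = {x \<in> \<Pi>\<^sub>E i\<in>I. carrier (M i). finite {i \<in> I. x i \<noteq> \<zero>\<^bsub>M i\<^esub>}},
     monoid.mult = undefined,
     one = undefined,
     zero = (\<lambda>i\<in>I. \<zero>\<^bsub>M i\<^esub>),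
     add = (\<lambda>x y. \<lambda>i\<in>I. x i \<oplus>\<^bsub>M i\<^esub> y i),
     ract = (\<lambda>x a. \<lambda>i\<in>I. x i \<lhd>\<^bsub>M i\<^esub> a)\<rparr>"


section \<open>The category of homomorphisms of right modules\<close>

record ('r, 'a, 'b) mor_obj =
  Dom :: "('r, 'a) rmodule"
  Cod :: "('r, 'b) rmodule"
  arr :: "'a \<Rightarrow> 'b"

definition Morph_Mod :: "'r ring \<Rightarrow> ('r, 'a, 'b) mor_obj set" where
  "Morph_Mod R = {M. right_module R (Dom M) \<and> right_module R (Cod M) \<and>
     arr M \<in> rmod_hom R (Dom M) (Cod M)}"

text \<open>The full subcategory \<open>Morph(\<L>)\<close>, for \<open>\<L>\<close> the class of right modules with local
  endomorphism ring.\<close>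

definition Morph_local :: "'r ring \<Rightarrow> ('r, 'a, 'b) mor_obj set" where
  "Morph_local R = {M \<in> Morph_Mod R.
     Dom M \<in> local_endo_modules R \<and> Cod M \<in> local_endo_modules R}"

definition Hom_Morph ::
    "'r ring \<Rightarrow> ('r, 'a, 'b) mor_obj \<Rightarrow> ('r, 'c, 'd) mor_obj \<Rightarrow> (('a \<Rightarrow> 'c) \<times> ('b \<Rightarrow> 'd)) set" where
  "Hom_Morph R M N = {(u\<^sub>0, u\<^sub>1). u\<^sub>0 \<in> rmod_hom R (Dom M) (Dom N) \<and>
     u\<^sub>1 \<in> rmod_hom R (Cod M) (Cod N) \<and>
     compose (carrier (Dom M)) u\<^sub>1 (arr M) = compose (carrier (Dom M)) (arr N) u\<^sub>0}"

text \<open>As for \<^const>\<open>compose\<close>, the first argument is the source of the composite.\<close>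

definition comp_Morph ::
    "('r, 'a, 'b) mor_obj \<Rightarrow> ('c \<Rightarrow> 'e) \<times> ('d \<Rightarrow> 'f) \<Rightarrow> ('a \<Rightarrow> 'c) \<times> ('b \<Rightarrow> 'd) \<Rightarrow>
     ('a \<Rightarrow> 'e) \<times> ('b \<Rightarrow> 'f)" where
  "comp_Morph M v u =
     (compose (carrier (Dom M)) (fst v) (fst u), compose (carrier (Cod M)) (snd v) (snd u))"

definition id_Morph :: "('r, 'a, 'b) mor_obj \<Rightarrow> ('a \<Rightarrow> 'a) \<times> ('b \<Rightarrow> 'b)" where
  "id_Morph M = (\<lambda>x\<in>carrier (Dom M). x, \<lambda>x\<in>carrier (Cod M). x)"

definition iso_Morph :: "'r ring \<Rightarrow> ('r, 'a, 'b) mor_obj \<Rightarrow> ('r, 'c, 'd) mor_obj \<Rightarrow> bool" where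
  "iso_Morph R M N \<longleftrightarrow> (\<exists>u\<in>Hom_Morph R M N. \<exists>v\<in>Hom_Morph R N M.
     comp_Morph M v u = id_Morph M \<and> comp_Morph N u v = id_Morph N)"

definition sum_Morph :: "'i set \<Rightarrow> ('i \<Rightarrow> ('r, 'a, 'b) mor_obj) \<Rightarrow>
    ('r, 'i \<Rightarrow> 'a, 'i \<Rightarrow> 'b) mor_obj" where
  "sum_Morph I M =
     \<lparr>Dom = rmod_sum I (\<lambda>i. Dom (M i)),
      Cod = rmod_sum I (\<lambda>i. Cod (M i)),
      arr = (\<lambda>x\<in>carrier (rmod_sum I (\<lambda>i. Dom (M i))). \<lambda>i\<in>I. arr (M i) (x i))\<rparr>"

definition same_domain_class ::
    "'r ring \<Rightarrow> ('r, 'a, 'b) mor_obj \<Rightarrow> ('r, 'c, 'd) mor_obj \<Rightarrow> bool" where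
  "same_domain_class R M N \<longleftrightarrow> (\<exists>u\<in>Hom_Morph R M N. \<exists>u'\<in>Hom_Morph R N M.
     fst u \<in> rmod_iso R (Dom M) (Dom N) \<and> fst u' \<in> rmod_iso R (Dom N) (Dom M))"

definition same_codomain_class ::
    "'r ring \<Rightarrow> ('r, 'a, 'b) mor_obj \<Rightarrow> ('r, 'c, 'd) mor_obj \<Rightarrow> bool" where
  "same_codomain_class R M N \<longleftrightarrow> (\<exists>u\<in>Hom_Morph R M N. \<exists>u'\<in>Hom_Morph R N M.
     snd u \<in> rmod_iso R (Cod M) (Cod N) \<and> snd u' \<in> rmod_iso R (Cod N) (Cod M))"

end

theory Submission
  imports Defs
begin

text \<open>The only input from locality is that non-invertible homomorphisms between modules with local endomorphism
  rings behave like an ideal: zero is not invertible, a sum with an invertible value has an invertible summand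
  (\<open>hom_add_iso_cases\<close>), and a composite is invertible only if both factors are
  (\<open>compose_iso_iff\<close>).  Matrices of such homomorphisms can therefore be treated as matrices over division rings, by
  Gaussian elimination on invertible pivots, as long as only the places of the invertible entries are recorded.
  Elimination has to take place among module homomorphisms, one component at a time: the inverse of an invertible
  component of a morphism need not be a component of a morphism.

  Let the two sums be isomorphic, with mutually inverse matrices \<open>U\<close> and \<open>V\<close>.  For one domain class, keep the
  summands belonging to it.  On domain components, the invertible entries of the product of the two blocks are
  the diagonal ones, because products that pass through a summand outside the class are not invertible.  Elimination then shows that the block
  on the \<open>M\<close> side is not larger than the one on the \<open>N\<close> side
  (\<open>card_le_if_product_iso_diagonal\<close>).  Taking all classes together gives an injection of indices preserving
  domain classes; by symmetry \<open>r = s\<close>, and the injection is a permutation.  The same is done with codomains.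

  Conversely, let the two permutations be given.  If one of them sends \<open>k\<close> to \<open>l\<close> and
  \<open>M\<^sub>k\<close> and \<open>N\<^sub>l\<close> share both classes, exchanging two values of the other makes it send \<open>k\<close> to \<open>l\<close> too; so
  the permutations may be assumed to differ only where this cannot happen (\<open>matchings_with_maximal_agreement\<close>).  Put a morphism invertible on domains at each place
  \<open>(\<phi>\<^sub>d k, k)\<close>, one invertible on codomains at each place \<open>(\<phi>\<^sub>c k, k)\<close>, an isomorphism where the two places coincide
  (\<open>iso_components_if_same_classes\<close>), and zero elsewhere.  On domains the invertible entries are those on the graph of
  \<open>\<phi>\<^sub>d\<close>, on codomains those on the graph of \<open>\<phi>\<^sub>c\<close>, and a matrix with such a pattern is invertible
  (\<open>matrix_hom_iso\<close>).\<close>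

section \<open>Homomorphisms of right modules\<close>

lemma right_module_abelian_group: "right_module R A \<Longrightarrow> abelian_group A"
  by (simp add: right_module_def)

lemma rmod_homI:
  assumes "\<And>x. x \<in> carrier A \<Longrightarrow> f x \<in> carrier B"
    and "\<And>x. x \<notin> carrier A \<Longrightarrow> f x = undefined"
    and "\<And>x y. \<lbrakk>x \<in> carrier A; y \<in> carrier A\<rbrakk> \<Longrightarrow> f (x \<oplus>\<^bsub>A\<^esub> y) = f x \<oplus>\<^bsub>B\<^esub> f y"
    and "\<And>x a. \<lbrakk>x \<in> carrier A; a \<in> carrier R\<rbrakk> \<Longrightarrow> f (x \<lhd>\<^bsub>A\<^esub> a) = f x \<lhd>\<^bsub>B\<^esub> a"
  shows "f \<in> rmod_hom R A B"
  unfolding rmod_hom_def using assms by (auto simp: PiE_def extensional_def)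

lemma rmod_hom_closed: "\<lbrakk>f \<in> rmod_hom R A B; x \<in> carrier A\<rbrakk> \<Longrightarrow> f x \<in> carrier B"
  and rmod_hom_add: "\<lbrakk>f \<in> rmod_hom R A B; x \<in> carrier A; y \<in> carrier A\<rbrakk> \<Longrightarrow>
    f (x \<oplus>\<^bsub>A\<^esub> y) = f x \<oplus>\<^bsub>B\<^esub> f y"
  and rmod_hom_ract: "\<lbrakk>f \<in> rmod_hom R A B; x \<in> carrier A; a \<in> carrier R\<rbrakk> \<Longrightarrow>
    f (x \<lhd>\<^bsub>A\<^esub> a) = f x \<lhd>\<^bsub>B\<^esub> a"
  and rmod_hom_undefined: "\<lbrakk>f \<in> rmod_hom R A B; x \<notin> carrier A\<rbrakk> \<Longrightarrow> f x = undefined"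
  by (auto simp: rmod_hom_def)

lemma rmod_hom_eqI:
  assumes "f \<in> rmod_hom R A B" "g \<in> rmod_hom R A B" "\<And>x. x \<in> carrier A \<Longrightarrow> f x = g x"
  shows "f = g"
  using assms by (metis ext rmod_hom_undefined)

lemma rmod_hom_zero:
  assumes "abelian_group A" "abelian_group B" and f: "f \<in> rmod_hom R A B"
  shows "f \<zero>\<^bsub>A\<^esub> = \<zero>\<^bsub>B\<^esub>"
proof -
  interpret A: abelian_group A by fact
  interpret B: abelian_group B by fact
  have "f \<zero>\<^bsub>A\<^esub> \<oplus>\<^bsub>B\<^esub> f \<zero>\<^bsub>A\<^esub> = f \<zero>\<^bsub>A\<^esub> \<oplus>\<^bsub>B\<^esub> \<zero>\<^bsub>B\<^esub>"
    using rmod_hom_add[OF f, of "\<zero>\<^bsub>A\<^esub>" "\<zero>\<^bsub>A\<^esub>"] rmod_hom_closed[OF f] by simp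
  then show ?thesis
    using rmod_hom_closed[OF f] by simp
qed

lemma rmod_hom_neg:
  assumes "abelian_group A" "abelian_group B" and f: "f \<in> rmod_hom R A B" and x: "x \<in> carrier A"
  shows "f (\<ominus>\<^bsub>A\<^esub> x) = \<ominus>\<^bsub>B\<^esub> f x"
proof -
  interpret A: abelian_group A by fact
  interpret B: abelian_group B by fact
  have "f (\<ominus>\<^bsub>A\<^esub> x) \<oplus>\<^bsub>B\<^esub> f x = \<zero>\<^bsub>B\<^esub>"
    using rmod_hom_add[OF f, of "\<ominus>\<^bsub>A\<^esub> x" x] x rmod_hom_zero[OF assms(1,2) f]
    by (simp add: A.l_neg)
  then show ?thesis
    using rmod_hom_closed[OF f] x by (simp add: B.minus_equality)
qed

lemma rmod_hom_finsum:
  assumes "abelian_group A" "abelian_group B" and f: "f \<in> rmod_hom R A B"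
    and "finite I" and "\<And>i. i \<in> I \<Longrightarrow> x i \<in> carrier A"
  shows "f (\<Oplus>\<^bsub>A\<^esub>i\<in>I. x i) = (\<Oplus>\<^bsub>B\<^esub>i\<in>I. f (x i))"
proof -
  interpret A: abelian_group A by fact
  interpret B: abelian_group B by fact
  show ?thesis using assms(4,5)
    by (induction I rule: finite_induct)
      (auto simp: rmod_hom_zero[OF assms(1,2) f] rmod_hom_add[OF f] rmod_hom_closed[OF f] Pi_def)
qed

lemma rmod_hom_id: "right_module R A \<Longrightarrow> (\<lambda>x\<in>carrier A. x) \<in> rmod_hom R A A"
  by (rule rmod_homI)
    (auto simp: abelian_groupE right_module_abelian_group right_module.ract_closed)

lemma rmod_hom_compose:
  assumes "right_module R A" and "f \<in> rmod_hom R A B" "g \<in> rmod_hom R B C"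
  shows "compose (carrier A) g f \<in> rmod_hom R A C"
  by (rule rmod_homI)
    (use assms in \<open>auto simp: compose_def abelian_groupE right_module_abelian_group
        right_module.ract_closed rmod_hom_closed rmod_hom_add rmod_hom_ract\<close>)

definition hom_zero :: "('r, 'a) rmodule \<Rightarrow> ('r, 'b) rmodule \<Rightarrow> 'a \<Rightarrow> 'b" where
  "hom_zero A B = (\<lambda>x\<in>carrier A. \<zero>\<^bsub>B\<^esub>)"

definition hom_add ::
    "('r, 'a) rmodule \<Rightarrow> ('r, 'b) rmodule \<Rightarrow> ('a \<Rightarrow> 'b) \<Rightarrow> ('a \<Rightarrow> 'b) \<Rightarrow> 'a \<Rightarrow> 'b" where
  "hom_add A B f g = (\<lambda>x\<in>carrier A. f x \<oplus>\<^bsub>B\<^esub> g x)"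

definition hom_neg ::
    "('r, 'a) rmodule \<Rightarrow> ('r, 'b) rmodule \<Rightarrow> ('a \<Rightarrow> 'b) \<Rightarrow> 'a \<Rightarrow> 'b" where
  "hom_neg A B f = (\<lambda>x\<in>carrier A. \<ominus>\<^bsub>B\<^esub> f x)"

definition hom_sum :: "('r, 'a) rmodule \<Rightarrow> ('r, 'b) rmodule \<Rightarrow> 'i set \<Rightarrow>
    ('i \<Rightarrow> 'a \<Rightarrow> 'b) \<Rightarrow> 'a \<Rightarrow> 'b" where
  "hom_sum A B I f = (\<lambda>x\<in>carrier A. \<Oplus>\<^bsub>B\<^esub>i\<in>I. f i x)"

lemma ract_zero:
  assumes "right_module R A" "a \<in> carrier R"
  shows "\<zero>\<^bsub>A\<^esub> \<lhd>\<^bsub>A\<^esub> a = \<zero>\<^bsub>A\<^esub>"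
proof -
  interpret A: abelian_group A using assms(1) by (rule right_module_abelian_group)
  have "\<zero>\<^bsub>A\<^esub> \<lhd>\<^bsub>A\<^esub> a \<oplus>\<^bsub>A\<^esub> \<zero>\<^bsub>A\<^esub> \<lhd>\<^bsub>A\<^esub> a = \<zero>\<^bsub>A\<^esub> \<lhd>\<^bsub>A\<^esub> a \<oplus>\<^bsub>A\<^esub> \<zero>\<^bsub>A\<^esub>"
    using right_module.ract_add_module[OF assms(1), of "\<zero>\<^bsub>A\<^esub>" "\<zero>\<^bsub>A\<^esub>" a] assms
    by (simp add: right_module.ract_closed)
  then show ?thesis using assms by (simp add: right_module.ract_closed)
qed

lemma ract_neg:
  assumes "right_module R A" "a \<in> carrier R" "x \<in> carrier A"
  shows "(\<ominus>\<^bsub>A\<^esub> x) \<lhd>\<^bsub>A\<^esub> a = \<ominus>\<^bsub>A\<^esub> (x \<lhd>\<^bsub>A\<^esub> a)"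
proof -
  interpret A: abelian_group A using assms(1) by (rule right_module_abelian_group)
  have "(\<ominus>\<^bsub>A\<^esub> x) \<lhd>\<^bsub>A\<^esub> a \<oplus>\<^bsub>A\<^esub> x \<lhd>\<^bsub>A\<^esub> a = \<zero>\<^bsub>A\<^esub>"
    using right_module.ract_add_module[OF assms(1), of "\<ominus>\<^bsub>A\<^esub> x" x a] assms
    by (simp add: A.l_neg ract_zero)
  then show ?thesis using assms by (simp add: right_module.ract_closed A.minus_equality)
qed

lemma hom_zero_in_rmod_hom:
  assumes "right_module R A" "right_module R B"
  shows "hom_zero A B \<in> rmod_hom R A B"
proof -
  interpret A: abelian_group A using assms(1) by (rule right_module_abelian_group)
  interpret B: abelian_group B using assms(2) by (rule right_module_abelian_group)
  show ?thesis
    by (rule rmod_homI)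
      (use assms in \<open>auto simp: hom_zero_def right_module.ract_closed ract_zero\<close>)
qed

lemma hom_add_in_rmod_hom:
  assumes "right_module R A" "right_module R B" "f \<in> rmod_hom R A B" "g \<in> rmod_hom R A B"
  shows "hom_add A B f g \<in> rmod_hom R A B"
proof -
  interpret A: abelian_group A using assms(1) by (rule right_module_abelian_group)
  interpret B: abelian_group B using assms(2) by (rule right_module_abelian_group)
  show ?thesis
    by (rule rmod_homI)
      (use assms in \<open>auto simp: hom_add_def right_module.ract_closed right_module.ract_add_module
          rmod_hom_closed rmod_hom_add rmod_hom_ract B.a_ac\<close>)
qed

lemma hom_neg_in_rmod_hom:
  assumes "right_module R A" "right_module R B" "f \<in> rmod_hom R A B"
  shows "hom_neg A B f \<in> rmod_hom R A B"
proof -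
  interpret A: abelian_group A using assms(1) by (rule right_module_abelian_group)
  interpret B: abelian_group B using assms(2) by (rule right_module_abelian_group)
  show ?thesis
    by (rule rmod_homI)
      (use assms in \<open>auto simp: hom_neg_def right_module.ract_closed ract_neg
          rmod_hom_closed rmod_hom_add rmod_hom_ract B.minus_add\<close>)
qed

lemma hom_sum_empty: "hom_sum A B {} f = hom_zero A B" if "abelian_group B"
proof -
  interpret B: abelian_group B by fact
  show ?thesis by (simp add: hom_sum_def hom_zero_def)
qed

lemma hom_sum_insert:
  assumes "right_module R B" "finite I" "i \<notin> I" "\<And>j. j \<in> insert i I \<Longrightarrow> f j \<in> rmod_hom R A B"
  shows "hom_sum A B (insert i I) f = hom_add A B (f i) (hom_sum A B I f)"
proof -
  interpret B: abelian_group B using assms(1) by (rule right_module_abelian_group)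
  have "f j x \<in> carrier B" if "j \<in> insert i I" "x \<in> carrier A" for j x
    using assms(4)[OF that(1)] that(2) by (rule rmod_hom_closed)
  then show ?thesis
    unfolding hom_sum_def hom_add_def
    by (intro restrict_ext) (use assms(2,3) in \<open>simp add: Pi_def\<close>)
qed

lemma hom_sum_in_rmod_hom:
  assumes "right_module R A" "right_module R B" "finite I"
    "\<And>i. i \<in> I \<Longrightarrow> f i \<in> rmod_hom R A B"
  shows "hom_sum A B I f \<in> rmod_hom R A B"
  using assms(3,4)
proof (induction I rule: finite_induct)
  case empty
  then show ?case
    using assms(1,2) by (simp add: hom_sum_empty hom_zero_in_rmod_hom right_module_abelian_group)
next
  case (insert i I)
  then show ?case
    using assms(1,2) hom_sum_insert[OF assms(2) insert.hyps insert.prems]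
    by (simp add: hom_add_in_rmod_hom)
qed

subsection \<open>Isomorphisms\<close>

lemma rmod_iso_hom: "f \<in> rmod_iso R A B \<Longrightarrow> f \<in> rmod_hom R A B"
  and rmod_iso_bij: "f \<in> rmod_iso R A B \<Longrightarrow> bij_betw f (carrier A) (carrier B)"
  by (auto simp: rmod_iso_def)

lemma rmod_iso_id: "right_module R A \<Longrightarrow> (\<lambda>x\<in>carrier A. x) \<in> rmod_iso R A A"
  by (auto simp: rmod_iso_def rmod_hom_id bij_betw_def inj_on_def)

lemma rmod_iso_compose:
  assumes "right_module R A" and "f \<in> rmod_iso R A B" "g \<in> rmod_iso R B C"
  shows "compose (carrier A) g f \<in> rmod_iso R A C"
  using assms unfolding rmod_iso_def
  by (auto intro: rmod_hom_compose bij_betw_compose)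

definition hom_inv :: "('r, 'a) rmodule \<Rightarrow> ('r, 'b) rmodule \<Rightarrow> ('a \<Rightarrow> 'b) \<Rightarrow> 'b \<Rightarrow> 'a" where
  "hom_inv A B f = (\<lambda>y\<in>carrier B. inv_into (carrier A) f y)"

lemma hom_inv_left: "\<lbrakk>f \<in> rmod_iso R A B; x \<in> carrier A\<rbrakk> \<Longrightarrow> hom_inv A B f (f x) = x"
  unfolding hom_inv_def rmod_iso_def using bij_betwE
  by (fastforce simp: bij_betw_inv_into_left)

lemma hom_inv_right: "\<lbrakk>f \<in> rmod_iso R A B; y \<in> carrier B\<rbrakk> \<Longrightarrow> f (hom_inv A B f y) = y"
  unfolding hom_inv_def by (simp add: bij_betw_inv_into_right[OF rmod_iso_bij])

lemma hom_inv_iso: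
  assumes A: "right_module R A" and f: "f \<in> rmod_iso R A B"
  shows "hom_inv A B f \<in> rmod_iso R B A"
proof -
  interpret A: abelian_group A using A by (rule right_module_abelian_group)
  have bij: "bij_betw (hom_inv A B f) (carrier B) (carrier A)"
    unfolding hom_inv_def using rmod_iso_bij[OF f] bij_betw_inv_into by fastforce
  then have cl: "hom_inv A B f y \<in> carrier A" if "y \<in> carrier B" for y
    using that bij_betwE by blast
  note hom = rmod_iso_hom[OF f]
  have "hom_inv A B f \<in> rmod_hom R B A"
  proof (rule rmod_homI)
    fix x y assume x: "x \<in> carrier B" and y: "y \<in> carrier B"
    have "x \<oplus>\<^bsub>B\<^esub> y = f (hom_inv A B f x \<oplus>\<^bsub>A\<^esub> hom_inv A B f y)"
      using x y by (simp add: rmod_hom_add[OF hom] cl hom_inv_right[OF f])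
    then show "hom_inv A B f (x \<oplus>\<^bsub>B\<^esub> y) = hom_inv A B f x \<oplus>\<^bsub>A\<^esub> hom_inv A B f y"
      using x y by (simp add: hom_inv_left[OF f] cl)
  next
    fix x a assume x: "x \<in> carrier B" and a: "a \<in> carrier R"
    have "x \<lhd>\<^bsub>B\<^esub> a = f (hom_inv A B f x \<lhd>\<^bsub>A\<^esub> a)"
      using x a by (simp add: rmod_hom_ract[OF hom] cl hom_inv_right[OF f])
    then show "hom_inv A B f (x \<lhd>\<^bsub>B\<^esub> a) = hom_inv A B f x \<lhd>\<^bsub>A\<^esub> a"
      using x a by (simp add: hom_inv_left[OF f] cl right_module.ract_closed[OF A])
  qed (use cl in \<open>auto simp: hom_inv_def\<close>)
  then show ?thesis using bij by (simp add: rmod_iso_def)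
qed

lemma hom_neg_iso:
  assumes A: "right_module R A" and B: "right_module R B" and f: "f \<in> rmod_iso R A B"
  shows "hom_neg A B f \<in> rmod_iso R A B"
proof -
  interpret B: abelian_group B using B by (rule right_module_abelian_group)
  have "bij_betw (a_inv B) (carrier B) (carrier B)"
    by (rule bij_betwI[where g = "a_inv B"]) auto
  then have "bij_betw (a_inv B \<circ> f) (carrier A) (carrier B)"
    using rmod_iso_bij[OF f] by (rule bij_betw_trans[rotated])
  moreover have "bij_betw (hom_neg A B f) (carrier A) (carrier B) = bij_betw (a_inv B \<circ> f) (carrier A) (carrier B)"
    by (rule bij_betw_cong) (simp add: hom_neg_def)
  ultimately show ?thesis
    using hom_neg_in_rmod_hom[OF A B rmod_iso_hom[OF f]] by (simp add: rmod_iso_def)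
qed

section \<open>Local endomorphism rings\<close>

lemma local_endo_right_module: "A \<in> local_endo_modules R \<Longrightarrow> right_module R A"
  by (simp add: local_endo_modules_def)

lemma Units_endo_ring:
  assumes A: "right_module R A"
  shows "Units (endo_ring R A) = rmod_iso R A A"
proof (intro equalityI subsetI)
  fix f assume "f \<in> Units (endo_ring R A)"
  then obtain g where f: "f \<in> rmod_hom R A A" and g: "g \<in> rmod_hom R A A"
    and gf: "compose (carrier A) g f = (\<lambda>x\<in>carrier A. x)"
    and fg: "compose (carrier A) f g = (\<lambda>x\<in>carrier A. x)"
    by (auto simp: Units_def endo_ring_def)
  have "g (f x) = x" "f (g x) = x" if "x \<in> carrier A" for x
    using that fun_cong[OF gf, of x] fun_cong[OF fg, of x] by (simp_all add: compose_def)
  then have "bij_betw f (carrier A) (carrier A)"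
    using rmod_hom_closed[OF f] rmod_hom_closed[OF g] by (intro bij_betwI[where g = g]) auto
  then show "f \<in> rmod_iso R A A" using f by (simp add: rmod_iso_def)
next
  fix f assume f: "f \<in> rmod_iso R A A"
  have g: "hom_inv A A f \<in> rmod_hom R A A"
    using hom_inv_iso[OF A f] by (rule rmod_iso_hom)
  have "compose (carrier A) (hom_inv A A f) f = (\<lambda>x\<in>carrier A. x)"
    "compose (carrier A) f (hom_inv A A f) = (\<lambda>x\<in>carrier A. x)"
    by (auto simp: compose_def fun_eq_iff hom_inv_left[OF f] hom_inv_right[OF f])
  then show "f \<in> Units (endo_ring R A)"
    using g rmod_iso_hom[OF f] by (auto simp: Units_def endo_ring_def)
qed

lemma local_endo_nontrivial:
  assumes A: "A \<in> local_endo_modules R"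
  shows "\<exists>x\<in>carrier A. x \<noteq> \<zero>\<^bsub>A\<^esub>"
proof (rule ccontr)
  assume "\<not> ?thesis"
  then have z: "\<And>x. x \<in> carrier A \<Longrightarrow> x = \<zero>\<^bsub>A\<^esub>" by blast
  let ?S = "endo_ring R A"
  interpret S: ring ?S using A by (simp add: local_endo_modules_def local_ring_def)
  interpret I: ideal "carrier ?S - Units ?S" ?S
    using A by (simp add: local_endo_modules_def local_ring_def)
  have "\<zero>\<^bsub>?S\<^esub> = \<one>\<^bsub>?S\<^esub>"
    unfolding endo_ring_def by (auto simp: fun_eq_iff restrict_def dest: z)
  moreover have "\<zero>\<^bsub>?S\<^esub> \<in> carrier ?S - Units ?S"
    using I.a_subset additive_subgroup.zero_closed[OF I.additive_subgroup_axioms] by blast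
  ultimately show False by simp
qed

text \<open>Composing with the inverse of \<open>f + g\<close> turns the sum into \<open>1\<close> in the local ring
  \<open>End A\<close>, whose non-units are closed under addition.\<close>
lemma hom_add_iso_cases:
  assumes A: "A \<in> local_endo_modules R" and B: "right_module R B"
    and f: "f \<in> rmod_hom R A B" and g: "g \<in> rmod_hom R A B"
    and iso: "hom_add A B f g \<in> rmod_iso R A B"
  shows "f \<in> rmod_iso R A B \<or> g \<in> rmod_iso R A B"
proof -
  let ?S = "endo_ring R A" and ?h = "hom_add A B f g"
  note A' = local_endo_right_module[OF A]
  interpret S: ring ?S using A by (simp add: local_endo_modules_def local_ring_def)
  interpret I: ideal "carrier ?S - Units ?S" ?S
    using A by (simp add: local_endo_modules_def local_ring_def)
  define p where "p = hom_inv A B ?h"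
  have p: "p \<in> rmod_iso R B A"
    unfolding p_def by (rule hom_inv_iso[OF A' iso])
  note pf = rmod_hom_compose[OF A' f rmod_iso_hom[OF p]]
    and pg = rmod_hom_compose[OF A' g rmod_iso_hom[OF p]]
  have one: "compose (carrier A) p f \<oplus>\<^bsub>?S\<^esub> compose (carrier A) p g = \<one>\<^bsub>?S\<^esub>"
  proof
    fix x show "(compose (carrier A) p f \<oplus>\<^bsub>?S\<^esub> compose (carrier A) p g) x = \<one>\<^bsub>?S\<^esub> x"
    proof (cases "x \<in> carrier A")
      case True
      then have "p (f x) \<oplus>\<^bsub>A\<^esub> p (g x) = p (?h x)"
        by (simp add: hom_add_def rmod_hom_add[OF rmod_iso_hom[OF p]] rmod_hom_closed[OF f]
            rmod_hom_closed[OF g])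
      then show ?thesis
        using True by (simp add: endo_ring_def compose_def p_def hom_inv_left[OF iso])
    qed (simp add: endo_ring_def)
  qed
  have cancel: "q \<in> rmod_iso R A B"
    if q: "q \<in> rmod_hom R A B" and pq: "compose (carrier A) p q \<in> Units ?S" for q
  proof -
    have "bij_betw (compose (carrier A) p q) (carrier A) (carrier A)"
      using pq by (simp add: Units_endo_ring[OF A'] rmod_iso_def)
    then have "bij_betw (p \<circ> q) (carrier A) (carrier A)"
      by (rule bij_betw_cong[THEN iffD1, rotated]) (simp add: compose_def)
    then have "bij_betw q (carrier A) (carrier B)"
      using bij_betw_comp_iff2[OF rmod_iso_bij[OF p], of q "carrier A"] rmod_hom_closed[OF q]
      by blast
    then show ?thesis using q by (simp add: rmod_iso_def)
  qed
  have "compose (carrier A) p f \<in> Units ?S \<or> compose (carrier A) p g \<in> Units ?S"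
  proof (rule ccontr)
    assume "\<not> ?thesis"
    then have "\<one>\<^bsub>?S\<^esub> \<in> carrier ?S - Units ?S"
      using additive_subgroup.a_closed[OF I.additive_subgroup_axioms,
          of "compose (carrier A) p f" "compose (carrier A) p g"] pf pg
      unfolding one by (simp add: endo_ring_def)
    then show False by simp
  qed
  then show ?thesis using cancel f g by blast
qed

lemma hom_neg_iso_iff:
  assumes A: "right_module R A" and B: "right_module R B" and f: "f \<in> rmod_hom R A B"
  shows "hom_neg A B f \<in> rmod_iso R A B \<longleftrightarrow> f \<in> rmod_iso R A B"
proof -
  interpret B: abelian_group B using B by (rule right_module_abelian_group)
  have "hom_neg A B (hom_neg A B f) = f"
    by (rule rmod_hom_eqI[OF hom_neg_in_rmod_hom[OF A B hom_neg_in_rmod_hom[OF A B f]] f])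
      (simp add: hom_neg_def rmod_hom_closed[OF f])
  then show ?thesis using hom_neg_iso[OF A B] by metis
qed

lemma hom_zero_not_iso:
  assumes A: "A \<in> local_endo_modules R"
  shows "hom_zero A B \<notin> rmod_iso R A B"
proof
  interpret A: abelian_group A
    using local_endo_right_module[OF A] by (rule right_module_abelian_group)
  assume "hom_zero A B \<in> rmod_iso R A B"
  then have "inj_on (hom_zero A B) (carrier A)" by (simp add: rmod_iso_def bij_betw_def)
  moreover obtain x where "x \<in> carrier A" "x \<noteq> \<zero>\<^bsub>A\<^esub>" using local_endo_nontrivial[OF A] by blast
  ultimately show False by (auto simp: hom_zero_def inj_on_def)
qed

text \<open>Non-invertible homomorphisms are negligible in sums.  This is the form in which locality is
  used below: it plays the part of passing to a division ring modulo the radical.\<close>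
lemma hom_add_iso_iff:
  assumes A: "A \<in> local_endo_modules R" and B: "right_module R B"
    and f: "f \<in> rmod_hom R A B" and g: "g \<in> rmod_hom R A B" "g \<notin> rmod_iso R A B"
  shows "hom_add A B f g \<in> rmod_iso R A B \<longleftrightarrow> f \<in> rmod_iso R A B"
proof
  show "hom_add A B f g \<in> rmod_iso R A B \<Longrightarrow> f \<in> rmod_iso R A B"
    using hom_add_iso_cases[OF A B f g(1)] g(2) by blast
next
  interpret B: abelian_group B using B by (rule right_module_abelian_group)
  assume iso: "f \<in> rmod_iso R A B"
  note A' = local_endo_right_module[OF A]
  note fg = hom_add_in_rmod_hom[OF A' B f g(1)] and ng = hom_neg_in_rmod_hom[OF A' B g(1)]
  have "hom_add A B (hom_add A B f g) (hom_neg A B g) = f"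
    by (rule rmod_hom_eqI[OF hom_add_in_rmod_hom[OF A' B fg ng] f])
      (simp add: hom_add_def hom_neg_def rmod_hom_closed[OF f] rmod_hom_closed[OF g(1)]
        B.a_assoc B.r_neg)
  then show "hom_add A B f g \<in> rmod_iso R A B"
    using hom_add_iso_cases[OF A B fg ng] iso g hom_neg_iso_iff[OF A' B g(1)] by auto
qed

lemma hom_add_comm:
  assumes B: "right_module R B" and f: "f \<in> rmod_hom R A B" and g: "g \<in> rmod_hom R A B"
  shows "hom_add A B f g = hom_add A B g f"
proof -
  interpret B: abelian_group B using B by (rule right_module_abelian_group)
  show ?thesis unfolding hom_add_def
    by (intro restrict_ext B.a_comm) (use f g in \<open>auto intro: rmod_hom_closed\<close>)
qed

lemma hom_sum_isoD:
  assumes A: "A \<in> local_endo_modules R" and B: "right_module R B" and "finite I"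
    and "\<And>i. i \<in> I \<Longrightarrow> f i \<in> rmod_hom R A B"
    and "hom_sum A B I f \<in> rmod_iso R A B"
  shows "\<exists>i\<in>I. f i \<in> rmod_iso R A B"
  using assms(3-)
proof (induction I rule: finite_induct)
  case empty
  then show ?case
    using hom_zero_not_iso[OF A, of B] by (simp add: hom_sum_empty[OF right_module_abelian_group[OF B]])
next
  case (insert i I)
  have "hom_sum A B I f \<in> rmod_hom R A B"
    by (rule hom_sum_in_rmod_hom[OF local_endo_right_module[OF A] B insert.hyps(1)])
      (simp add: insert.prems)
  then show ?case
    using hom_add_iso_cases[OF A B, of "f i" "hom_sum A B I f"] insert
      hom_sum_insert[OF B insert.hyps, of f A] by auto
qed

text \<open>If \<open>g f\<close> is invertible then \<open>e = f (g f)\<^sup>-\<^sup>1 g\<close> is an idempotent of \<open>End B\<close>; as \<open>End B\<close>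
  is local, \<open>e\<close> or \<open>1 - e\<close> is invertible, so \<open>e\<close> is \<open>1\<close> or \<open>0\<close>, and it is not \<open>0\<close>
  because \<open>g e f = g f\<close> is an isomorphism from a nonzero module.\<close>
lemma compose_iso_iff:
  assumes A: "A \<in> local_endo_modules R" and B: "B \<in> local_endo_modules R"
    and C: "right_module R C"
    and f: "f \<in> rmod_hom R A B" and g: "g \<in> rmod_hom R B C"
  shows "compose (carrier A) g f \<in> rmod_iso R A C \<longleftrightarrow>
    f \<in> rmod_iso R A B \<and> g \<in> rmod_iso R B C"
proof
  note A' = local_endo_right_module[OF A] and B' = local_endo_right_module[OF B]
  show "f \<in> rmod_iso R A B \<and> g \<in> rmod_iso R B C \<Longrightarrow> compose (carrier A) g f \<in> rmod_iso R A C"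
    using rmod_iso_compose[OF A'] by blast
  assume iso: "compose (carrier A) g f \<in> rmod_iso R A C"
  interpret A: abelian_group A using A' by (rule right_module_abelian_group)
  interpret B: abelian_group B using B' by (rule right_module_abelian_group)
  interpret C: abelian_group C using C by (rule right_module_abelian_group)
  define p where "p = hom_inv A C (compose (carrier A) g f)"
  have p: "p \<in> rmod_hom R C A"
    unfolding p_def using hom_inv_iso[OF A' iso] by (rule rmod_iso_hom)
  have pgf: "p (g (f x)) = x" if "x \<in> carrier A" for x
    using hom_inv_left[OF iso that] that by (simp add: p_def compose_def)
  have gfp: "g (f (p z)) = z" if "z \<in> carrier C" for z
    using hom_inv_right[OF iso that] rmod_hom_closed[OF p that] by (simp add: p_def compose_def)
  define e where "e = compose (carrier B) f (compose (carrier B) p g)"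
  have e: "e \<in> rmod_hom R B B"
    unfolding e_def by (rule rmod_hom_compose[OF B' rmod_hom_compose[OF B' g p] f])
  have e_eq: "e y = f (p (g y))" if "y \<in> carrier B" for y
    using that by (simp add: e_def compose_def)
  have ee: "e (e y) = e y" if "y \<in> carrier B" for y
    using that rmod_hom_closed[OF e] rmod_hom_closed[OF g] rmod_hom_closed[OF p]
    by (simp add: e_eq pgf rmod_hom_closed[OF f])
  define i where "i = (\<lambda>y\<in>carrier B. y)"
  have i: "i \<in> rmod_hom R B B" unfolding i_def by (rule rmod_hom_id[OF B'])
  define d where "d = hom_add B B i (hom_neg B B e)"
  have d: "d \<in> rmod_hom R B B"
    unfolding d_def by (rule hom_add_in_rmod_hom[OF B' B' i hom_neg_in_rmod_hom[OF B' B' e]])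
  have d_eq: "d y = y \<oplus>\<^bsub>B\<^esub> \<ominus>\<^bsub>B\<^esub> e y" if "y \<in> carrier B" for y
    using that by (simp add: d_def hom_add_def hom_neg_def i_def)
  have "hom_add B B d e = i"
    by (rule rmod_hom_eqI[OF hom_add_in_rmod_hom[OF B' B' d e] i])
      (simp add: hom_add_def d_eq i_def rmod_hom_closed[OF e] B.a_assoc B.l_neg)
  moreover have "i \<in> rmod_iso R B B" unfolding i_def by (rule rmod_iso_id[OF B'])
  ultimately have "d \<in> rmod_iso R B B \<or> e \<in> rmod_iso R B B"
    using hom_add_iso_cases[OF B B' d e] by simp
  then have e_id: "e y = y" if y: "y \<in> carrier B" for y
  proof
    assume "e \<in> rmod_iso R B B"
    then have "inj_on e (carrier B)" by (simp add: rmod_iso_def bij_betw_def)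
    then show ?thesis
      using ee[OF y] y rmod_hom_closed[OF e] by (auto dest: inj_onD)
  next
    assume dis: "d \<in> rmod_iso R B B"
    have "d (e y) = d \<zero>\<^bsub>B\<^esub>" if "y \<in> carrier B" for y
      using that rmod_hom_closed[OF e] rmod_hom_zero[OF B.abelian_group_axioms B.abelian_group_axioms d]
      by (simp add: d_eq ee B.r_neg)
    moreover have "inj_on d (carrier B)" using dis by (simp add: rmod_iso_def bij_betw_def)
    ultimately have e0: "e y = \<zero>\<^bsub>B\<^esub>" if "y \<in> carrier B" for y
      using that rmod_hom_closed[OF e] by (meson B.zero_closed inj_onD)
    obtain x where x: "x \<in> carrier A" "x \<noteq> \<zero>\<^bsub>A\<^esub>" using local_endo_nontrivial[OF A] by blast
    have "x = p (g (e (f x)))"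
      using x by (simp add: e_eq pgf rmod_hom_closed[OF f])
    also have "\<dots> = \<zero>\<^bsub>A\<^esub>"
      using x rmod_hom_zero[OF B.abelian_group_axioms C.abelian_group_axioms g]
        rmod_hom_zero[OF C.abelian_group_axioms A.abelian_group_axioms p]
      by (simp add: e0 rmod_hom_closed[OF f])
    finally show ?thesis using x by simp
  qed
  have "bij_betw f (carrier A) (carrier B)"
    by (rule bij_betwI[where g = "\<lambda>y. p (g y)"])
      (use e_id in \<open>auto simp: pgf e_eq rmod_hom_closed[OF f] rmod_hom_closed[OF p] rmod_hom_closed[OF g]\<close>)
  moreover have "bij_betw g (carrier B) (carrier C)"
    by (rule bij_betwI[where g = "\<lambda>z. f (p z)"])
      (use e_id in \<open>auto simp: gfp e_eq rmod_hom_closed[OF f] rmod_hom_closed[OF p] rmod_hom_closed[OF g]\<close>)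
  ultimately show "f \<in> rmod_iso R A B \<and> g \<in> rmod_iso R B C"
    using f g by (simp add: rmod_iso_def)
qed

section \<open>Gaussian elimination over local endomorphism rings\<close>

text \<open>The matrix obtained from \<open>f\<close> by subtracting multiples of column \<open>k\<^sub>0\<close> so that row \<open>l\<^sub>0\<close> becomes zero
  outside the pivot \<open>f l\<^sub>0 k\<^sub>0\<close>: the entry \<open>f\<^bsub>l k\<^esub>\<close> becomes
  \<open>f\<^bsub>l k\<^esub> - f\<^bsub>l k\<^sub>0\<^esub> p f\<^bsub>l\<^sub>0 k\<^esub>\<close>, where \<open>p\<close> is the inverse of the pivot.\<close>
definition pivot_eliminate :: "('k \<Rightarrow> ('r, 'a) rmodule) \<Rightarrow> ('l \<Rightarrow> ('r, 'b) rmodule) \<Rightarrow> 'l \<Rightarrow> 'k \<Rightarrow>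
    ('l \<Rightarrow> 'k \<Rightarrow> 'a \<Rightarrow> 'b) \<Rightarrow> 'l \<Rightarrow> 'k \<Rightarrow> 'a \<Rightarrow> 'b" where
  "pivot_eliminate A B l\<^sub>0 k\<^sub>0 f l k =
     hom_add (A k) (B l) (f l k) (hom_neg (A k) (B l)
       (compose (carrier (A k)) (f l k\<^sub>0)
         (compose (carrier (A k)) (hom_inv (A k\<^sub>0) (B l\<^sub>0) (f l\<^sub>0 k\<^sub>0)) (f l\<^sub>0 k))))"

lemma pivot_eliminate_apply:
  "x \<in> carrier (A k) \<Longrightarrow> pivot_eliminate A B l\<^sub>0 k\<^sub>0 f l k x =
     f l k x \<oplus>\<^bsub>B l\<^esub> \<ominus>\<^bsub>B l\<^esub> f l k\<^sub>0 (hom_inv (A k\<^sub>0) (B l\<^sub>0) (f l\<^sub>0 k\<^sub>0) (f l\<^sub>0 k x))"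
  by (simp add: pivot_eliminate_def hom_add_def hom_neg_def compose_def)

lemma pivot_correction_hom:
  assumes "right_module R (A k)" "right_module R (A k\<^sub>0)"
    and "f l k\<^sub>0 \<in> rmod_hom R (A k\<^sub>0) (B l)" "f l\<^sub>0 k \<in> rmod_hom R (A k) (B l\<^sub>0)"
    and "f l\<^sub>0 k\<^sub>0 \<in> rmod_iso R (A k\<^sub>0) (B l\<^sub>0)"
  shows "compose (carrier (A k)) (hom_inv (A k\<^sub>0) (B l\<^sub>0) (f l\<^sub>0 k\<^sub>0)) (f l\<^sub>0 k) \<in> rmod_hom R (A k) (A k\<^sub>0)"
    and "compose (carrier (A k)) (f l k\<^sub>0)
      (compose (carrier (A k)) (hom_inv (A k\<^sub>0) (B l\<^sub>0) (f l\<^sub>0 k\<^sub>0)) (f l\<^sub>0 k)) \<in> rmod_hom R (A k) (B l)"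
proof -
  show *: "compose (carrier (A k)) (hom_inv (A k\<^sub>0) (B l\<^sub>0) (f l\<^sub>0 k\<^sub>0)) (f l\<^sub>0 k)
    \<in> rmod_hom R (A k) (A k\<^sub>0)"
    using assms by (meson hom_inv_iso rmod_hom_compose rmod_iso_hom)
  show "compose (carrier (A k)) (f l k\<^sub>0)
      (compose (carrier (A k)) (hom_inv (A k\<^sub>0) (B l\<^sub>0) (f l\<^sub>0 k\<^sub>0)) (f l\<^sub>0 k)) \<in> rmod_hom R (A k) (B l)"
    using assms * by (meson rmod_hom_compose)
qed

lemma pivot_eliminate_hom:
  assumes "right_module R (A k)" "right_module R (A k\<^sub>0)" "right_module R (B l)"
    and "f l k \<in> rmod_hom R (A k) (B l)" "f l k\<^sub>0 \<in> rmod_hom R (A k\<^sub>0) (B l)"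
    and "f l\<^sub>0 k \<in> rmod_hom R (A k) (B l\<^sub>0)" "f l\<^sub>0 k\<^sub>0 \<in> rmod_iso R (A k\<^sub>0) (B l\<^sub>0)"
  shows "pivot_eliminate A B l\<^sub>0 k\<^sub>0 f l k \<in> rmod_hom R (A k) (B l)"
  unfolding pivot_eliminate_def
  by (intro hom_add_in_rmod_hom hom_neg_in_rmod_hom pivot_correction_hom(2) assms)

text \<open>The correction factors through \<open>f l k\<^sub>0\<close>, so it is negligible as soon as that entry is not
  invertible.\<close>
lemma pivot_eliminate_iso_iff:
  assumes A: "A k \<in> local_endo_modules R" "A k\<^sub>0 \<in> local_endo_modules R"
    and B: "right_module R (B l)"
    and f: "f l k \<in> rmod_hom R (A k) (B l)" "f l k\<^sub>0 \<in> rmod_hom R (A k\<^sub>0) (B l)"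
      "f l\<^sub>0 k \<in> rmod_hom R (A k) (B l\<^sub>0)" "f l\<^sub>0 k\<^sub>0 \<in> rmod_iso R (A k\<^sub>0) (B l\<^sub>0)"
    and column: "f l k\<^sub>0 \<notin> rmod_iso R (A k\<^sub>0) (B l)"
  shows "pivot_eliminate A B l\<^sub>0 k\<^sub>0 f l k \<in> rmod_iso R (A k) (B l) \<longleftrightarrow>
    f l k \<in> rmod_iso R (A k) (B l)"
proof -
  note A' = A[THEN local_endo_right_module]
  let ?p = "compose (carrier (A k)) (hom_inv (A k\<^sub>0) (B l\<^sub>0) (f l\<^sub>0 k\<^sub>0)) (f l\<^sub>0 k)"
  let ?c = "compose (carrier (A k)) (f l k\<^sub>0) ?p"
  have p: "?p \<in> rmod_hom R (A k) (A k\<^sub>0)" and c: "?c \<in> rmod_hom R (A k) (B l)"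
    using pivot_correction_hom[where f = f and l = l, OF A' f(2-4)] by simp_all
  have "?c \<notin> rmod_iso R (A k) (B l)"
    using compose_iso_iff[OF A B p f(2)] column by simp
  then show ?thesis
    unfolding pivot_eliminate_def
    using hom_add_iso_iff[OF A(1) B f(1) hom_neg_in_rmod_hom[OF A'(1) B c]]
      hom_neg_iso_iff[OF A'(1) B c] by simp
qed

text \<open>Over a division ring, the identity on \<open>K\<close> cannot factor through fewer than \<open>card K\<close> dimensions; here
  ``invertible'' takes the place of ``nonzero''.  An invertible diagonal entry of \<open>V U\<close>
  has an invertible summand, which provides a pivot \<open>U l\<^sub>0 k\<^sub>0\<close>.  Eliminating it replaces \<open>W = V U\<close> by
  \<open>W\<^bsub>k k'\<^esub> - W\<^bsub>k k\<^sub>0\<^esub> p U\<^bsub>l\<^sub>0 k'\<^esub>\<close> on the remaining indices.  As \<open>W\<^bsub>k k\<^sub>0\<^esub>\<close> is not invertible for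
  \<open>k \<noteq> k\<^sub>0\<close>, the invertible entries still are those on the diagonal.  Asking for this pattern
  instead of \<open>W = 1\<close> is what makes the induction work.\<close>
lemma card_le_if_product_iso_diagonal:
  assumes "finite K" and "finite L"
    and "\<And>k. k \<in> K \<Longrightarrow> A k \<in> local_endo_modules R" and "\<And>l. l \<in> L \<Longrightarrow> B l \<in> local_endo_modules R"
    and "\<And>k l. \<lbrakk>k \<in> K; l \<in> L\<rbrakk> \<Longrightarrow> U l k \<in> rmod_hom R (A k) (B l)"
    and "\<And>k l. \<lbrakk>k \<in> K; l \<in> L\<rbrakk> \<Longrightarrow> V k l \<in> rmod_hom R (B l) (A k)"
    and "\<And>k k'. \<lbrakk>k \<in> K; k' \<in> K\<rbrakk> \<Longrightarrow>
      hom_sum (A k') (A k) L (\<lambda>l. compose (carrier (A k')) (V k l) (U l k')) \<in> rmod_iso R (A k') (A k)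
        \<longleftrightarrow> k = k'"
  shows "card K \<le> card L"
  using assms
proof (induction K arbitrary: L U rule: finite_induct)
  case empty
  then show ?case by simp
next
  case (insert k\<^sub>0 K)
  note finL = insert.prems(1) and A = insert.prems(2) and B = insert.prems(3)
    and U = insert.prems(4) and V = insert.prems(5) and diag = insert.prems(6)
  note A' = A[THEN local_endo_right_module] and B' = B[THEN local_endo_right_module]
  have VU: "compose (carrier (A k')) (V k l) (U l k') \<in> rmod_hom R (A k') (A k)"
    if "k \<in> insert k\<^sub>0 K" "k' \<in> insert k\<^sub>0 K" "l \<in> L" for k k' l
    using rmod_hom_compose[OF A'[OF that(2)] U[OF that(2,3)] V[OF that(1,3)]] .
  have k\<^sub>0: "k\<^sub>0 \<in> insert k\<^sub>0 K" by blast
  have "\<exists>l\<in>L. compose (carrier (A k\<^sub>0)) (V k\<^sub>0 l) (U l k\<^sub>0) \<in> rmod_iso R (A k\<^sub>0) (A k\<^sub>0)"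
    using diag[OF k\<^sub>0 k\<^sub>0] by (intro hom_sum_isoD[OF A[OF k\<^sub>0] A'[OF k\<^sub>0] finL VU[OF k\<^sub>0 k\<^sub>0]]) auto
  then obtain l\<^sub>0 where l\<^sub>0: "l\<^sub>0 \<in> L"
    and "compose (carrier (A k\<^sub>0)) (V k\<^sub>0 l\<^sub>0) (U l\<^sub>0 k\<^sub>0) \<in> rmod_iso R (A k\<^sub>0) (A k\<^sub>0)"
    by (rule bexE)
  then have pivot: "U l\<^sub>0 k\<^sub>0 \<in> rmod_iso R (A k\<^sub>0) (B l\<^sub>0)"
    using compose_iso_iff[OF A[OF k\<^sub>0] B[OF l\<^sub>0] A'[OF k\<^sub>0] U[OF k\<^sub>0 l\<^sub>0] V[OF k\<^sub>0 l\<^sub>0]] by simp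
  let ?U = "pivot_eliminate A B l\<^sub>0 k\<^sub>0 U"
  have U': "?U l k \<in> rmod_hom R (A k) (B l)" if "k \<in> K" "l \<in> L" for l k
    using that l\<^sub>0 by (intro pivot_eliminate_hom A' B' U pivot) auto
  have diag': "hom_sum (A k') (A k) (L - {l\<^sub>0}) (\<lambda>l. compose (carrier (A k')) (V k l) (?U l k'))
      \<in> rmod_iso R (A k') (A k) \<longleftrightarrow> k = k'" (is "?W' \<in> _ \<longleftrightarrow> _") if k: "k \<in> K" and k': "k' \<in> K" for k k'
  proof -
    have kk: "k \<in> insert k\<^sub>0 K" "k' \<in> insert k\<^sub>0 K" "k\<^sub>0 \<in> insert k\<^sub>0 K" using k k' by auto
    have "k \<noteq> k\<^sub>0" using k insert.hyps by blast
    let ?p = "hom_inv (A k\<^sub>0) (B l\<^sub>0) (U l\<^sub>0 k\<^sub>0)"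
    let ?q = "compose (carrier (A k')) ?p (U l\<^sub>0 k')"
    let ?W = "\<lambda>j. hom_sum (A j) (A k) L (\<lambda>l. compose (carrier (A j)) (V k l) (U l j))"
    let ?c = "compose (carrier (A k')) (?W k\<^sub>0) ?q"
    have p: "?p \<in> rmod_hom R (B l\<^sub>0) (A k\<^sub>0)"
      using hom_inv_iso[OF A'[OF kk(3)] pivot] by (rule rmod_iso_hom)
    have q: "?q \<in> rmod_hom R (A k') (A k\<^sub>0)"
      by (rule rmod_hom_compose[OF A'[OF kk(2)] U[OF kk(2) l\<^sub>0] p])
    have W: "?W j \<in> rmod_hom R (A j) (A k)" if "j \<in> insert k\<^sub>0 K" for j
      by (rule hom_sum_in_rmod_hom[OF A'[OF that] A'[OF kk(1)] finL VU[OF kk(1) that]])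
    have c: "?c \<in> rmod_hom R (A k') (A k)"
      by (rule rmod_hom_compose[OF A'[OF kk(2)] q W[OF kk(3)]])
    have "?W k\<^sub>0 \<notin> rmod_iso R (A k\<^sub>0) (A k)" using diag[OF kk(1,3)] \<open>k \<noteq> k\<^sub>0\<close> by simp
    then have c_not_iso: "?c \<notin> rmod_iso R (A k') (A k)"
      using compose_iso_iff[OF A[OF kk(2)] A[OF kk(3)] A'[OF kk(1)] q W[OF kk(3)]] by simp
    have nc: "hom_neg (A k') (A k) ?c \<in> rmod_hom R (A k') (A k)"
      by (rule hom_neg_in_rmod_hom[OF A'[OF kk(2)] A'[OF kk(1)] c])
    have "?W' = hom_add (A k') (A k) (?W k') (hom_neg (A k') (A k) ?c)"
    proof (rule rmod_hom_eqI)
      show "?W' \<in> rmod_hom R (A k') (A k)"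
        using finL k k' by (intro hom_sum_in_rmod_hom rmod_hom_compose[OF _ U' V] A') auto
      show "hom_add (A k') (A k) (?W k') (hom_neg (A k') (A k) ?c) \<in> rmod_hom R (A k') (A k)"
        by (rule hom_add_in_rmod_hom[OF A'[OF kk(2)] A'[OF kk(1)] W[OF kk(2)] nc])
      fix x assume x: "x \<in> carrier (A k')"
      interpret C: abelian_group "A k" using A'[OF kk(1)] by (rule right_module_abelian_group)
      have agB: "abelian_group (B l)" if "l \<in> L" for l
        using B'[OF that] by (rule right_module_abelian_group)
      define z where "z = ?p (U l\<^sub>0 k' x)"
      have z: "z \<in> carrier (A k\<^sub>0)"
        unfolding z_def using rmod_hom_closed[OF p] rmod_hom_closed[OF U[OF kk(2) l\<^sub>0] x] by blast
      \<comment> \<open>Applying the eliminated row to \<open>x\<close> is applying the old row to \<open>x\<close> minus the pivot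
        column at \<open>z\<close>; in the pivot row the two cancel, so that row may be added to the sum.\<close>
      define y where "y l = U l k' x \<oplus>\<^bsub>B l\<^esub> \<ominus>\<^bsub>B l\<^esub> U l k\<^sub>0 z" for l
      have Ux: "U l k' x \<in> carrier (B l)" and Uz: "U l k\<^sub>0 z \<in> carrier (B l)" if "l \<in> L" for l
        using rmod_hom_closed[OF U[OF kk(2) that] x] rmod_hom_closed[OF U[OF kk(3) that] z] by auto
      have y: "y l \<in> carrier (B l)" and y_add: "y l \<oplus>\<^bsub>B l\<^esub> U l k\<^sub>0 z = U l k' x" if "l \<in> L" for l
      proof -
        interpret Bl: abelian_group "B l" by (rule agB[OF that])
        show "y l \<in> carrier (B l)" "y l \<oplus>\<^bsub>B l\<^esub> U l k\<^sub>0 z = U l k' x"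
          using Ux[OF that] Uz[OF that] by (simp_all add: y_def Bl.a_assoc Bl.l_neg)
      qed
      have "U l\<^sub>0 k\<^sub>0 z = U l\<^sub>0 k' x"
        unfolding z_def by (rule hom_inv_right[OF pivot Ux[OF l\<^sub>0]])
      then have y\<^sub>0: "y l\<^sub>0 = \<zero>\<^bsub>B l\<^sub>0\<^esub>"
        using Ux[OF l\<^sub>0] abelian_group.r_neg[OF agB[OF l\<^sub>0]] by (simp add: y_def)
      have Vy: "V k l (y l) \<in> carrier (A k)" and VUz: "V k l (U l k\<^sub>0 z) \<in> carrier (A k)" if "l \<in> L" for l
        using rmod_hom_closed[OF V[OF kk(1) that]] y[OF that] Uz[OF that] by auto
      have "?W' x = (\<Oplus>\<^bsub>A k\<^esub>l\<in>L - {l\<^sub>0}. V k l (y l))"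
        using x by (simp add: hom_sum_def compose_def pivot_eliminate_apply y_def z_def)
      also have "\<dots> = (\<Oplus>\<^bsub>A k\<^esub>l\<in>insert l\<^sub>0 (L - {l\<^sub>0}). V k l (y l))"
        using finL Vy l\<^sub>0 rmod_hom_zero[OF agB[OF l\<^sub>0] C.abelian_group_axioms V[OF kk(1) l\<^sub>0]]
        by (subst C.finsum_insert) (auto simp: y\<^sub>0)
      also have "insert l\<^sub>0 (L - {l\<^sub>0}) = L" using l\<^sub>0 by blast
      finally have W': "?W' x = (\<Oplus>\<^bsub>A k\<^esub>l\<in>L. V k l (y l))" .
      have "?W' x \<oplus>\<^bsub>A k\<^esub> ?W k\<^sub>0 z
          = (\<Oplus>\<^bsub>A k\<^esub>l\<in>L. V k l (y l) \<oplus>\<^bsub>A k\<^esub> V k l (U l k\<^sub>0 z))"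
        unfolding W' using z Vy VUz by (subst C.finsum_addf) (auto simp: hom_sum_def compose_def)
      also have "\<dots> = (\<Oplus>\<^bsub>A k\<^esub>l\<in>L. V k l (U l k' x))"
        by (rule C.finsum_cong')
          (auto simp: rmod_hom_add[OF V[OF kk(1)], symmetric] y Uz y_add Ux rmod_hom_closed[OF V[OF kk(1)]])
      also have "\<dots> = ?W k' x" using x by (simp add: hom_sum_def compose_def)
      finally have *: "?W k' x = ?W' x \<oplus>\<^bsub>A k\<^esub> ?W k\<^sub>0 z" by simp
      have "?W' x \<in> carrier (A k)" unfolding W' using Vy by (intro C.finsum_closed) auto
      moreover have "?W k\<^sub>0 z \<in> carrier (A k)" by (rule rmod_hom_closed[OF W[OF kk(3)] z])
      moreover have "?c x = ?W k\<^sub>0 z" using x by (simp add: compose_def z_def)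
      ultimately show "?W' x = hom_add (A k') (A k) (?W k') (hom_neg (A k') (A k) ?c) x"
        using x unfolding hom_add_def hom_neg_def by (simp add: * C.a_assoc C.r_neg)
    qed
    then show ?thesis
      using hom_add_iso_iff[OF A[OF kk(2)] A'[OF kk(1)] W[OF kk(2)] nc]
        hom_neg_iso_iff[OF A'[OF kk(2)] A'[OF kk(1)] c] c_not_iso diag[OF kk(1,2)] by simp
  qed
  have "card K \<le> card (L - {l\<^sub>0})"
    by (rule insert.IH[of "L - {l\<^sub>0}" ?U]) (use finL A B U' V diag' in auto)
  then show ?case
    using insert.hyps finL l\<^sub>0 card_gt_0_iff[of L] by (auto simp: card_Diff_singleton)
qed

lemma (in abelian_group) add_eq_iff_eq_diff:
  assumes "x \<in> carrier G" "y \<in> carrier G" "z \<in> carrier G"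
  shows "x \<oplus> y = z \<longleftrightarrow> x = z \<oplus> \<ominus> y"
  using assms by (metis a_assoc a_inv_closed l_neg r_neg r_zero)

lemma (in abelian_group) add_diff_cancel:
  "\<lbrakk>x \<in> carrier G; y \<in> carrier G\<rbrakk> \<Longrightarrow> x \<oplus> (y \<oplus> \<ominus> x) = y"
  by (simp add: a_lcomm[of x y] r_neg)

text \<open>A matrix whose invertible entries are exactly those on the graph of a bijection is a permuted
  diagonal matrix modulo the radical, hence should be invertible.  Elimination proves this without
  forming the inverse: the row \<open>\<phi> k\<^sub>0\<close> determines \<open>x k\<^sub>0\<close> from the other unknowns, and substituting this
  into the other rows leaves a system on \<open>K\<close> whose entries are invertible in the same places.\<close>
lemma ex1_solution_if_iso_pattern_bijective:
  assumes "finite K" and "inj_on \<phi> K"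
    and "\<And>k. k \<in> K \<Longrightarrow> A k \<in> local_endo_modules R" and "\<And>l. l \<in> \<phi> ` K \<Longrightarrow> B l \<in> local_endo_modules R"
    and "\<And>k l. \<lbrakk>k \<in> K; l \<in> \<phi> ` K\<rbrakk> \<Longrightarrow> f l k \<in> rmod_hom R (A k) (B l)"
    and "\<And>k l. \<lbrakk>k \<in> K; l \<in> \<phi> ` K\<rbrakk> \<Longrightarrow> f l k \<in> rmod_iso R (A k) (B l) \<longleftrightarrow> l = \<phi> k"
    and "\<And>l. l \<in> \<phi> ` K \<Longrightarrow> y l \<in> carrier (B l)"
  shows "\<exists>!x. x \<in> (\<Pi>\<^sub>E k\<in>K. carrier (A k)) \<and> (\<forall>l\<in>\<phi> ` K. (\<Oplus>\<^bsub>B l\<^esub>k\<in>K. f l k (x k)) = y l)"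
  using assms
proof (induction K arbitrary: f y rule: finite_induct)
  case empty
  then show ?case by auto
next
  case (insert k\<^sub>0 K)
  note A = insert.prems(2) and B = insert.prems(3) and f = insert.prems(4)
    and iso = insert.prems(5) and y = insert.prems(6)
  note A' = A[THEN local_endo_right_module] and B' = B[THEN local_endo_right_module]
  have agA: "abelian_group (A k)" if "k \<in> insert k\<^sub>0 K" for k
    using A'[OF that] by (rule right_module_abelian_group)
  have agB: "abelian_group (B l)" if "l \<in> \<phi> ` insert k\<^sub>0 K" for l
    using B'[OF that] by (rule right_module_abelian_group)
  define l\<^sub>0 where "l\<^sub>0 = \<phi> k\<^sub>0"
  have k\<^sub>0: "k\<^sub>0 \<in> insert k\<^sub>0 K" and l\<^sub>0: "l\<^sub>0 \<in> \<phi> ` insert k\<^sub>0 K" by (auto simp: l\<^sub>0_def)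
  have sub: "k \<in> insert k\<^sub>0 K" if "k \<in> K" for k using that by blast
  have sub': "l \<in> \<phi> ` insert k\<^sub>0 K" if "l \<in> \<phi> ` K" for l using that by blast
  have l_ne: "l \<noteq> l\<^sub>0" if "l \<in> \<phi> ` K" for l
    using that insert.prems(1) insert.hyps(2) unfolding l\<^sub>0_def
    by (metis imageE inj_onD insertI1 insertI2)
  have pivot: "f l\<^sub>0 k\<^sub>0 \<in> rmod_iso R (A k\<^sub>0) (B l\<^sub>0)" using iso[OF k\<^sub>0 l\<^sub>0] l\<^sub>0_def by simp
  define p where "p = hom_inv (A k\<^sub>0) (B l\<^sub>0) (f l\<^sub>0 k\<^sub>0)"
  have p: "p \<in> rmod_hom R (B l\<^sub>0) (A k\<^sub>0)"
    unfolding p_def using hom_inv_iso[OF A'[OF k\<^sub>0] pivot] by (rule rmod_iso_hom)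
  have p_right: "f l\<^sub>0 k\<^sub>0 (p z) = z" if "z \<in> carrier (B l\<^sub>0)" for z
    unfolding p_def using that by (rule hom_inv_right[OF pivot])
  have p_left: "p (f l\<^sub>0 k\<^sub>0 z) = z" if "z \<in> carrier (A k\<^sub>0)" for z
    unfolding p_def using that by (rule hom_inv_left[OF pivot])
  interpret B\<^sub>0: abelian_group "B l\<^sub>0" by (rule agB[OF l\<^sub>0])
  interpret A\<^sub>0: abelian_group "A k\<^sub>0" by (rule agA[OF k\<^sub>0])
  let ?g = "pivot_eliminate A B l\<^sub>0 k\<^sub>0 f"
  let ?z = "\<lambda>l. y l \<oplus>\<^bsub>B l\<^esub> \<ominus>\<^bsub>B l\<^esub> f l k\<^sub>0 (p (y l\<^sub>0))"
  let ?b = "\<lambda>x. y l\<^sub>0 \<oplus>\<^bsub>B l\<^sub>0\<^esub> \<ominus>\<^bsub>B l\<^sub>0\<^esub> (\<Oplus>\<^bsub>B l\<^sub>0\<^esub>k\<in>K. f l\<^sub>0 k (x k))"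
  have g: "?g l k \<in> rmod_hom R (A k) (B l)" if "k \<in> K" "l \<in> \<phi> ` K" for l k
    using that by (intro pivot_eliminate_hom A' B' f pivot k\<^sub>0 l\<^sub>0) auto
  have g_iso: "?g l k \<in> rmod_iso R (A k) (B l) \<longleftrightarrow> l = \<phi> k" if "k \<in> K" "l \<in> \<phi> ` K" for l k
  proof -
    have "f l k\<^sub>0 \<notin> rmod_iso R (A k\<^sub>0) (B l)"
      using iso[OF k\<^sub>0 sub'[OF that(2)]] l_ne[OF that(2)] by (simp add: l\<^sub>0_def)
    from pivot_eliminate_iso_iff[where f = f, OF A[OF sub[OF that(1)]] A[OF k\<^sub>0] B'[OF sub'[OF that(2)]]
        f[OF sub[OF that(1)] sub'[OF that(2)]] f[OF k\<^sub>0 sub'[OF that(2)]] f[OF sub[OF that(1)] l\<^sub>0] pivot this]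
    show ?thesis using iso[OF sub[OF that(1)] sub'[OF that(2)]] by simp
  qed
  have py: "p (y l\<^sub>0) \<in> carrier (A k\<^sub>0)" by (rule rmod_hom_closed[OF p y[OF l\<^sub>0]])
  have z: "?z l \<in> carrier (B l)" if "l \<in> \<phi> ` K" for l
  proof -
    interpret Bl: abelian_group "B l" by (rule agB[OF sub'[OF that]])
    show ?thesis using y[OF sub'[OF that]] rmod_hom_closed[OF f[OF k\<^sub>0 sub'[OF that]] py] by simp
  qed
  have solution_iff: "(\<forall>l\<in>\<phi> ` insert k\<^sub>0 K. (\<Oplus>\<^bsub>B l\<^esub>k\<in>insert k\<^sub>0 K. f l k (x k)) = y l) \<longleftrightarrow>
      x k\<^sub>0 = p (?b x) \<and> (\<forall>l\<in>\<phi> ` K. (\<Oplus>\<^bsub>B l\<^esub>k\<in>K. ?g l k (x k)) = ?z l)"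
    if x: "\<And>k. k \<in> insert k\<^sub>0 K \<Longrightarrow> x k \<in> carrier (A k)" for x
  proof -
    have fx: "f l k (x k) \<in> carrier (B l)" if "k \<in> insert k\<^sub>0 K" "l \<in> \<phi> ` insert k\<^sub>0 K" for k l
      using rmod_hom_closed[OF f[OF that] x[OF that(1)]] .
    let ?S = "\<lambda>l. \<Oplus>\<^bsub>B l\<^esub>k\<in>K. f l k (x k)"
    have S: "?S l \<in> carrier (B l)" if l: "l \<in> \<phi> ` insert k\<^sub>0 K" for l
    proof -
      interpret Bl: abelian_group "B l" by (rule agB[OF l])
      show ?thesis by (rule Bl.finsum_closed) (use fx l in auto)
    qed
    have split: "(\<Oplus>\<^bsub>B l\<^esub>k\<in>insert k\<^sub>0 K. f l k (x k)) = f l k\<^sub>0 (x k\<^sub>0) \<oplus>\<^bsub>B l\<^esub> ?S l"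
      if l: "l \<in> \<phi> ` insert k\<^sub>0 K" for l
    proof -
      interpret Bl: abelian_group "B l" by (rule agB[OF l])
      show ?thesis by (rule Bl.finsum_insert) (use insert.hyps fx l in auto)
    qed
    have row\<^sub>0: "(\<Oplus>\<^bsub>B l\<^sub>0\<^esub>k\<in>insert k\<^sub>0 K. f l\<^sub>0 k (x k)) = y l\<^sub>0 \<longleftrightarrow> x k\<^sub>0 = p (?b x)"
    proof -
      have "(\<Oplus>\<^bsub>B l\<^sub>0\<^esub>k\<in>insert k\<^sub>0 K. f l\<^sub>0 k (x k)) = y l\<^sub>0 \<longleftrightarrow> f l\<^sub>0 k\<^sub>0 (x k\<^sub>0) = ?b x"
        unfolding split[OF l\<^sub>0] using fx[OF k\<^sub>0 l\<^sub>0] S[OF l\<^sub>0] y[OF l\<^sub>0] by (rule B\<^sub>0.add_eq_iff_eq_diff)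
      also have "\<dots> \<longleftrightarrow> x k\<^sub>0 = p (?b x)"
        using p_left[OF x[OF k\<^sub>0]] p_right[of "?b x"] S[OF l\<^sub>0] y[OF l\<^sub>0] by auto
      finally show ?thesis .
    qed
    have row: "(\<Oplus>\<^bsub>B l\<^esub>k\<in>insert k\<^sub>0 K. f l k (x k)) = y l \<longleftrightarrow> (\<Oplus>\<^bsub>B l\<^esub>k\<in>K. ?g l k (x k)) = ?z l"
      if x\<^sub>0: "x k\<^sub>0 = p (?b x)" and l: "l \<in> \<phi> ` K" for l
    proof -
      note l' = sub'[OF l]
      interpret Bl: abelian_group "B l" by (rule agB[OF l'])
      let ?c = "\<lambda>k. f l k\<^sub>0 (p (f l\<^sub>0 k (x k)))"
      let ?T = "\<Oplus>\<^bsub>B l\<^esub>k\<in>K. ?g l k (x k)"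
      note f\<^sub>0 = f[OF k\<^sub>0 l']
      have c: "?c k \<in> carrier (B l)" if "k \<in> K" for k
        using rmod_hom_closed[OF f\<^sub>0 rmod_hom_closed[OF p fx[OF sub[OF that] l\<^sub>0]]] .
      have T: "?T \<in> carrier (B l)"
        by (rule Bl.finsum_closed) (use rmod_hom_closed[OF g x[OF sub]] l in auto)
      have gx: "?g l k (x k) \<oplus>\<^bsub>B l\<^esub> ?c k = f l k (x k)" if "k \<in> K" for k
        using c[OF that] fx[OF sub[OF that] l'] x[OF sub[OF that]]
        by (simp add: pivot_eliminate_apply p_def Bl.a_assoc Bl.l_neg)
      have "f l k\<^sub>0 (p (?S l\<^sub>0)) = (\<Oplus>\<^bsub>B l\<^esub>k\<in>K. ?c k)"
        using fx l\<^sub>0 rmod_hom_closed[OF p]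
        by (simp add: rmod_hom_finsum[OF B\<^sub>0.abelian_group_axioms A\<^sub>0.abelian_group_axioms p insert.hyps(1)]
            rmod_hom_finsum[OF A\<^sub>0.abelian_group_axioms Bl.abelian_group_axioms f\<^sub>0 insert.hyps(1)])
      moreover have "?T \<oplus>\<^bsub>B l\<^esub> (\<Oplus>\<^bsub>B l\<^esub>k\<in>K. ?c k) = (\<Oplus>\<^bsub>B l\<^esub>k\<in>K. ?g l k (x k) \<oplus>\<^bsub>B l\<^esub> ?c k)"
        by (rule Bl.finsum_addf[symmetric]) (use c rmod_hom_closed[OF g x[OF sub]] l in auto)
      moreover have "(\<Oplus>\<^bsub>B l\<^esub>k\<in>K. ?g l k (x k) \<oplus>\<^bsub>B l\<^esub> ?c k) = ?S l"
        by (rule Bl.finsum_cong') (use gx fx[OF sub l'] in auto)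
      ultimately have S_eq: "?S l = ?T \<oplus>\<^bsub>B l\<^esub> f l k\<^sub>0 (p (?S l\<^sub>0))" by simp
      have pS: "p (?S l\<^sub>0) \<in> carrier (A k\<^sub>0)" by (rule rmod_hom_closed[OF p S[OF l\<^sub>0]])
      have "f l k\<^sub>0 (x k\<^sub>0) = f l k\<^sub>0 (p (y l\<^sub>0)) \<oplus>\<^bsub>B l\<^esub> \<ominus>\<^bsub>B l\<^esub> f l k\<^sub>0 (p (?S l\<^sub>0))"
        unfolding x\<^sub>0 using y[OF l\<^sub>0] S[OF l\<^sub>0] py pS
        by (simp add: rmod_hom_add[OF p] rmod_hom_neg[OF B\<^sub>0.abelian_group_axioms A\<^sub>0.abelian_group_axioms p]
            rmod_hom_add[OF f\<^sub>0] rmod_hom_neg[OF A\<^sub>0.abelian_group_axioms Bl.abelian_group_axioms f\<^sub>0])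
      then have "f l k\<^sub>0 (x k\<^sub>0) \<oplus>\<^bsub>B l\<^esub> ?S l = ?T \<oplus>\<^bsub>B l\<^esub> f l k\<^sub>0 (p (y l\<^sub>0))"
        unfolding S_eq using T rmod_hom_closed[OF f\<^sub>0 py] rmod_hom_closed[OF f\<^sub>0 pS]
        by (simp add: Bl.a_ac Bl.add_diff_cancel)
      then show ?thesis
        unfolding split[OF l'] using Bl.add_eq_iff_eq_diff[OF T rmod_hom_closed[OF f\<^sub>0 py] y[OF l']] by simp
    qed
    show ?thesis using row\<^sub>0 row by (auto simp: l\<^sub>0_def)
  qed
  have "\<exists>!x. x \<in> (\<Pi>\<^sub>E k\<in>K. carrier (A k)) \<and> (\<forall>l\<in>\<phi> ` K. (\<Oplus>\<^bsub>B l\<^esub>k\<in>K. ?g l k (x k)) = ?z l)"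
    by (rule insert.IH[of ?g ?z]) (use insert.prems(1) A B g g_iso z in auto)
  then obtain x where "x \<in> (\<Pi>\<^sub>E k\<in>K. carrier (A k)) \<and> (\<forall>l\<in>\<phi> ` K. (\<Oplus>\<^bsub>B l\<^esub>k\<in>K. ?g l k (x k)) = ?z l)"
    and unique: "\<forall>x'. x' \<in> (\<Pi>\<^sub>E k\<in>K. carrier (A k)) \<and> (\<forall>l\<in>\<phi> ` K. (\<Oplus>\<^bsub>B l\<^esub>k\<in>K. ?g l k (x' k)) = ?z l)
      \<longrightarrow> x' = x"
    by (rule ex1E)
  then have x: "x \<in> (\<Pi>\<^sub>E k\<in>K. carrier (A k))"
    and x_sol: "\<And>l. l \<in> \<phi> ` K \<Longrightarrow> (\<Oplus>\<^bsub>B l\<^esub>k\<in>K. ?g l k (x k)) = ?z l"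
    and x_unique: "\<And>x'. \<lbrakk>x' \<in> (\<Pi>\<^sub>E k\<in>K. carrier (A k));
      \<forall>l\<in>\<phi> ` K. (\<Oplus>\<^bsub>B l\<^esub>k\<in>K. ?g l k (x' k)) = ?z l\<rbrakk> \<Longrightarrow> x' = x"
    using unique by blast+
  have b_cong: "?b w = ?b w'" and g_cong: "l \<in> \<phi> ` K \<Longrightarrow>
      (\<Oplus>\<^bsub>B l\<^esub>k\<in>K. ?g l k (w k)) = (\<Oplus>\<^bsub>B l\<^esub>k\<in>K. ?g l k (w' k))"
    if "\<And>k. k \<in> K \<Longrightarrow> w k = w' k" "\<And>k. k \<in> K \<Longrightarrow> w' k \<in> carrier (A k)" for w w' l
  proof -
    show "?b w = ?b w'"
      by (rule arg_cong[where f = "\<lambda>s. y l\<^sub>0 \<oplus>\<^bsub>B l\<^sub>0\<^esub> \<ominus>\<^bsub>B l\<^sub>0\<^esub> s"], rule B\<^sub>0.finsum_cong')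
        (use that rmod_hom_closed[OF f[OF sub l\<^sub>0]] in auto)
    assume l: "l \<in> \<phi> ` K"
    interpret Bl: abelian_group "B l" by (rule agB[OF sub'[OF l]])
    show "(\<Oplus>\<^bsub>B l\<^esub>k\<in>K. ?g l k (w k)) = (\<Oplus>\<^bsub>B l\<^esub>k\<in>K. ?g l k (w' k))"
      by (rule Bl.finsum_cong') (use that rmod_hom_closed[OF g[OF _ l]] in auto)
  qed
  have b_closed: "?b w \<in> carrier (B l\<^sub>0)" if "\<And>k. k \<in> K \<Longrightarrow> w k \<in> carrier (A k)" for w
  proof -
    have "(\<Oplus>\<^bsub>B l\<^sub>0\<^esub>k\<in>K. f l\<^sub>0 k (w k)) \<in> carrier (B l\<^sub>0)"
      by (rule B\<^sub>0.finsum_closed) (use that rmod_hom_closed[OF f[OF sub l\<^sub>0]] in auto)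
    then show ?thesis using y[OF l\<^sub>0] by simp
  qed
  have xA: "x k \<in> carrier (A k)" if "k \<in> K" for k using x that by auto
  define x' where "x' = x(k\<^sub>0 := p (?b x))"
  have x'x: "x' k = x k" if "k \<in> K" for k using that insert.hyps by (auto simp: x'_def)
  have x'A: "x' k \<in> carrier (A k)" if "k \<in> insert k\<^sub>0 K" for k
    using that xA rmod_hom_closed[OF p b_closed[OF xA]] by (auto simp: x'_def)
  show ?case
  proof (rule ex1I[of _ x'], intro conjI)
    show "x' \<in> (\<Pi>\<^sub>E k\<in>insert k\<^sub>0 K. carrier (A k))"
    proof (rule PiE_I)
      show "x' k = undefined" if "k \<notin> insert k\<^sub>0 K" for k
        using that x by (auto simp: x'_def PiE_def extensional_def)
    qed (rule x'A)
    have "x' k\<^sub>0 = p (?b x')" using b_cong[OF x'x xA] by (simp add: x'_def)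
    then show "\<forall>l\<in>\<phi> ` insert k\<^sub>0 K. (\<Oplus>\<^bsub>B l\<^esub>k\<in>insert k\<^sub>0 K. f l k (x' k)) = y l"
      using g_cong[OF x'x xA] x_sol by (intro iffD2[OF solution_iff[of x']] x'A) auto
  next
    fix w assume w: "w \<in> (\<Pi>\<^sub>E k\<in>insert k\<^sub>0 K. carrier (A k)) \<and>
      (\<forall>l\<in>\<phi> ` insert k\<^sub>0 K. (\<Oplus>\<^bsub>B l\<^esub>k\<in>insert k\<^sub>0 K. f l k (w k)) = y l)"
    then have wA: "w k \<in> carrier (A k)" if "k \<in> insert k\<^sub>0 K" for k using that by auto
    from w have w\<^sub>0: "w k\<^sub>0 = p (?b w)"
      and w_sol: "\<forall>l\<in>\<phi> ` K. (\<Oplus>\<^bsub>B l\<^esub>k\<in>K. ?g l k (w k)) = ?z l"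
      using solution_iff[of w, OF wA] by auto
    have "restrict w K = x"
    proof (rule x_unique)
      show "restrict w K \<in> (\<Pi>\<^sub>E k\<in>K. carrier (A k))" using wA by auto
      show "\<forall>l\<in>\<phi> ` K. (\<Oplus>\<^bsub>B l\<^esub>k\<in>K. ?g l k (restrict w K k)) = ?z l"
        using w_sol g_cong[of "restrict w K" w] wA by auto
    qed
    then have wx: "w k = x k" if "k \<in> K" for k using that by (metis restrict_apply')
    show "w = x'"
    proof
      fix k
      consider "k = k\<^sub>0" | "k \<in> K" | "k \<notin> insert k\<^sub>0 K" by blast
      then show "w k = x' k"
      proof cases
        case 1
        then show ?thesis using w\<^sub>0 b_cong[OF wx xA] by (simp add: x'_def)
      next
        case 2
        then show ?thesis by (simp add: wx x'x)
      next
        case 3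
        then have "w k = undefined" using w by (auto simp: PiE_def extensional_def)
        then show ?thesis using 3 x by (auto simp: x'_def PiE_def extensional_def)
      qed
    qed
  qed
qed

section \<open>Finite direct sums of modules\<close>

lemma rmod_sum_carrier: "finite I \<Longrightarrow> carrier (rmod_sum I A) = (\<Pi>\<^sub>E i\<in>I. carrier (A i))"
  by (auto simp: rmod_sum_def)

lemma rmod_sum_simps:
  "\<zero>\<^bsub>rmod_sum I A\<^esub> = (\<lambda>i\<in>I. \<zero>\<^bsub>A i\<^esub>)"
  "x \<oplus>\<^bsub>rmod_sum I A\<^esub> y = (\<lambda>i\<in>I. x i \<oplus>\<^bsub>A i\<^esub> y i)"
  "x \<lhd>\<^bsub>rmod_sum I A\<^esub> a = (\<lambda>i\<in>I. x i \<lhd>\<^bsub>A i\<^esub> a)"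
  by (simp_all add: rmod_sum_def)

lemma rmod_sum_component: "\<lbrakk>finite I; x \<in> carrier (rmod_sum I A); i \<in> I\<rbrakk> \<Longrightarrow> x i \<in> carrier (A i)"
  by (auto simp: rmod_sum_carrier)

lemma rmod_sum_right_module:
  assumes "ring R" and I: "finite I" and A: "\<And>i. i \<in> I \<Longrightarrow> right_module R (A i)"
  shows "right_module R (rmod_sum I A)"
proof (intro right_module.intro right_module_axioms.intro)
  note A_group = A[THEN right_module_abelian_group]
  note A_monoid = A_group[THEN abelian_group.axioms(1)]
  note monoid_facts = abelian_monoid.a_closed[OF A_monoid] abelian_monoid.zero_closed[OF A_monoid]
    abelian_monoid.a_assoc[OF A_monoid] abelian_monoid.a_comm[OF A_monoid]
    abelian_monoid.a_lcomm[OF A_monoid] abelian_monoid.l_zero[OF A_monoid]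
    abelian_monoid.r_zero[OF A_monoid]
  show "abelian_group (rmod_sum I A)"
  proof (rule abelian_groupI)
    fix x assume x: "x \<in> carrier (rmod_sum I A)"
    have xi: "x i \<in> carrier (A i)" if "i \<in> I" for i using rmod_sum_component[OF I x that] .
    show "\<exists>y\<in>carrier (rmod_sum I A). y \<oplus>\<^bsub>rmod_sum I A\<^esub> x = \<zero>\<^bsub>rmod_sum I A\<^esub>"
    proof
      show "(\<lambda>i\<in>I. \<ominus>\<^bsub>A i\<^esub> x i) \<in> carrier (rmod_sum I A)"
        using xi A_group by (auto simp: rmod_sum_carrier[OF I] abelian_group.a_inv_closed)
      show "(\<lambda>i\<in>I. \<ominus>\<^bsub>A i\<^esub> x i) \<oplus>\<^bsub>rmod_sum I A\<^esub> x = \<zero>\<^bsub>rmod_sum I A\<^esub>"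
        using xi A_group by (auto simp: rmod_sum_simps abelian_group.l_neg intro!: restrict_ext)
    qed
  qed (auto simp: rmod_sum_carrier[OF I] rmod_sum_simps PiE_def Pi_def extensional_def fun_eq_iff
      restrict_def monoid_facts)
qed (use assms in \<open>auto simp: rmod_sum_carrier[OF I] rmod_sum_simps right_module.ract_closed[OF A]
    right_module.ract_add_ring[OF A] right_module.ract_add_module[OF A] right_module.ract_mult[OF A]
    right_module.ract_one[OF A] PiE_def Pi_def extensional_def fun_eq_iff restrict_def\<close>)

definition sum_inj :: "'i set \<Rightarrow> ('i \<Rightarrow> ('r, 'a) rmodule) \<Rightarrow> 'i \<Rightarrow> 'a \<Rightarrow> 'i \<Rightarrow> 'a" where
  "sum_inj I A i = (\<lambda>x\<in>carrier (A i). \<lambda>j\<in>I. if j = i then x else \<zero>\<^bsub>A j\<^esub>)"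

definition sum_proj :: "'i set \<Rightarrow> ('i \<Rightarrow> ('r, 'a) rmodule) \<Rightarrow> 'i \<Rightarrow> ('i \<Rightarrow> 'a) \<Rightarrow> 'a" where
  "sum_proj I A i = (\<lambda>x\<in>carrier (rmod_sum I A). x i)"

lemma sum_inj_hom:
  assumes I: "finite I" and A: "\<And>i. i \<in> I \<Longrightarrow> right_module R (A i)" and i: "i \<in> I"
  shows "sum_inj I A i \<in> rmod_hom R (A i) (rmod_sum I A)"
proof -
  note A_group = A[THEN right_module_abelian_group]
  note group_facts = abelian_groupE[OF A_group]
  show ?thesis
    using A i
    by (intro rmod_homI)
      (auto simp: sum_inj_def rmod_sum_carrier[OF I] rmod_sum_simps group_facts ract_zero[OF A]
        right_module.ract_closed[OF A] fun_eq_iff restrict_def)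
qed

lemma sum_proj_hom:
  assumes "ring R" and I: "finite I" and A: "\<And>i. i \<in> I \<Longrightarrow> right_module R (A i)" and i: "i \<in> I"
  shows "sum_proj I A i \<in> rmod_hom R (rmod_sum I A) (A i)"
proof -
  note S = rmod_sum_right_module[OF assms(1-3)]
  show ?thesis
    using i abelian_groupE(1)[OF right_module_abelian_group[OF S]] right_module.ract_closed[OF S]
    by (intro rmod_homI)
      (auto simp: sum_proj_def rmod_sum_component[OF I] rmod_sum_simps)
qed

text \<open>The element \<open>y\<close> is built up one component at a time, so that sums are only ever taken in \<open>C\<close>.\<close>
lemma hom_rmod_sum_decompose:
  assumes "ring R" and I: "finite I" and A: "\<And>i. i \<in> I \<Longrightarrow> right_module R (A i)"
    and C: "right_module R C" and h: "h \<in> rmod_hom R (rmod_sum I A) C"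
    and y: "y \<in> carrier (rmod_sum I A)"
  shows "h y = (\<Oplus>\<^bsub>C\<^esub>i\<in>I. h (sum_inj I A i (y i)))"
proof -
  note S = rmod_sum_right_module[OF assms(1-3)]
  note A_group = A[THEN right_module_abelian_group]
  interpret S: abelian_group "rmod_sum I A" using S by (rule right_module_abelian_group)
  interpret C: abelian_group C using C by (rule right_module_abelian_group)
  let ?t = "\<lambda>F. \<lambda>i\<in>I. if i \<in> F then y i else \<zero>\<^bsub>A i\<^esub>"
  have yi: "y i \<in> carrier (A i)" if "i \<in> I" for i using rmod_sum_component[OF I y that] .
  have inj: "sum_inj I A i (y i) \<in> carrier (rmod_sum I A)" if "i \<in> I" for i
    using rmod_hom_closed[OF sum_inj_hom[where A = A, OF I A that] yi[OF that]] by simp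
  have t: "?t F \<in> carrier (rmod_sum I A)" for F
    using yi A_group by (auto simp: rmod_sum_carrier[OF I] abelian_groupE(2))
  have "h (?t F) = (\<Oplus>\<^bsub>C\<^esub>i\<in>F. h (sum_inj I A i (y i)))" if "F \<subseteq> I" for F
    using finite_subset[OF that I] that
  proof (induction F rule: finite_induct)
    case empty
    have "?t {} = \<zero>\<^bsub>rmod_sum I A\<^esub>" by (auto simp: rmod_sum_simps)
    then show ?case
      using rmod_hom_zero[OF S.abelian_group_axioms C.abelian_group_axioms h] by simp
  next
    case (insert i F)
    have "?t (insert i F) = sum_inj I A i (y i) \<oplus>\<^bsub>rmod_sum I A\<^esub> ?t F"
      using insert.hyps insert.prems yi A_group
      by (auto simp: rmod_sum_simps sum_inj_def fun_eq_iff restrict_def abelian_groupE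
          abelian_monoid.r_zero abelian_group.axioms)
    then have "h (?t (insert i F)) = h (sum_inj I A i (y i)) \<oplus>\<^bsub>C\<^esub> h (?t F)"
      using rmod_hom_add[OF h inj t] insert.prems by simp
    also have "h (?t F) = (\<Oplus>\<^bsub>C\<^esub>i\<in>F. h (sum_inj I A i (y i)))"
      using insert.IH insert.prems by blast
    also have "h (sum_inj I A i (y i)) \<oplus>\<^bsub>C\<^esub> \<dots> = (\<Oplus>\<^bsub>C\<^esub>i\<in>insert i F. h (sum_inj I A i (y i)))"
      by (rule C.finsum_insert[symmetric]) (use insert rmod_hom_closed[OF h inj] in auto)
    finally show ?case .
  qed
  moreover have "?t I = y"
    using y by (auto simp: rmod_sum_carrier[OF I] fun_eq_iff restrict_def PiE_def extensional_def)
  ultimately show ?thesis by (metis order_refl)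
qed

subsection \<open>Matrices of homomorphisms\<close>

definition hom_entry :: "'i set \<Rightarrow> ('i \<Rightarrow> ('r, 'a) rmodule) \<Rightarrow> 'j set \<Rightarrow> ('j \<Rightarrow> ('r, 'b) rmodule) \<Rightarrow>
    (('i \<Rightarrow> 'a) \<Rightarrow> 'j \<Rightarrow> 'b) \<Rightarrow> 'j \<Rightarrow> 'i \<Rightarrow> 'a \<Rightarrow> 'b" where
  "hom_entry I A J B u j i =
     compose (carrier (A i)) (sum_proj J B j) (compose (carrier (A i)) u (sum_inj I A i))"

lemma hom_entry_hom:
  assumes "ring R" and "finite I" "\<And>i. i \<in> I \<Longrightarrow> right_module R (A i)"
    and "finite J" "\<And>j. j \<in> J \<Longrightarrow> right_module R (B j)"
    and "u \<in> rmod_hom R (rmod_sum I A) (rmod_sum J B)" and "i \<in> I" "j \<in> J"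
  shows "hom_entry I A J B u j i \<in> rmod_hom R (A i) (B j)"
  unfolding hom_entry_def
  using assms by (blast intro: rmod_hom_compose sum_inj_hom sum_proj_hom)

definition matrix_hom :: "'i set \<Rightarrow> ('i \<Rightarrow> ('r, 'a) rmodule) \<Rightarrow> 'j set \<Rightarrow> ('j \<Rightarrow> ('r, 'b) rmodule) \<Rightarrow>
    ('j \<Rightarrow> 'i \<Rightarrow> 'a \<Rightarrow> 'b) \<Rightarrow> ('i \<Rightarrow> 'a) \<Rightarrow> 'j \<Rightarrow> 'b" where
  "matrix_hom I A J B f = (\<lambda>x\<in>carrier (rmod_sum I A). \<lambda>j\<in>J. \<Oplus>\<^bsub>B j\<^esub>i\<in>I. f j i (x i))"

lemma matrix_hom_hom:
  assumes "ring R" and I: "finite I" and A: "\<And>i. i \<in> I \<Longrightarrow> right_module R (A i)"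
    and J: "finite J" and B: "\<And>j. j \<in> J \<Longrightarrow> right_module R (B j)"
    and f: "\<And>i j. \<lbrakk>i \<in> I; j \<in> J\<rbrakk> \<Longrightarrow> f j i \<in> rmod_hom R (A i) (B j)"
  shows "matrix_hom I A J B f \<in> rmod_hom R (rmod_sum I A) (rmod_sum J B)"
proof -
  note S = rmod_sum_right_module[OF assms(1-3)]
  interpret S: abelian_group "rmod_sum I A" using S by (rule right_module_abelian_group)
  have fx: "f j i (x i) \<in> carrier (B j)" if "x \<in> carrier (rmod_sum I A)" "i \<in> I" "j \<in> J" for x i j
    using rmod_hom_closed[OF f[OF that(2,3)] rmod_sum_component[OF I that(1,2)]] .
  have row: "(\<lambda>x\<in>carrier (rmod_sum I A). \<Oplus>\<^bsub>B j\<^esub>i\<in>I. f j i (x i)) \<in> rmod_hom R (rmod_sum I A) (B j)"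
    if j: "j \<in> J" for j
  proof -
    have "hom_sum (rmod_sum I A) (B j) I (\<lambda>i. compose (carrier (rmod_sum I A)) (f j i) (sum_proj I A i))
        \<in> rmod_hom R (rmod_sum I A) (B j)"
      by (intro hom_sum_in_rmod_hom S B I j rmod_hom_compose[OF S sum_proj_hom[OF assms(1-3)]] f)
    then show ?thesis
      by (simp add: hom_sum_def compose_def sum_proj_def cong: restrict_cong)
  qed
  show ?thesis
  proof (rule rmod_homI)
    fix x assume x: "x \<in> carrier (rmod_sum I A)"
    then show "matrix_hom I A J B f x \<in> carrier (rmod_sum J B)"
      using rmod_hom_closed[OF row x] by (auto simp: matrix_hom_def rmod_sum_carrier[OF J])
  next
    fix x y assume xy: "x \<in> carrier (rmod_sum I A)" "y \<in> carrier (rmod_sum I A)"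
    show "matrix_hom I A J B f (x \<oplus>\<^bsub>rmod_sum I A\<^esub> y) =
        matrix_hom I A J B f x \<oplus>\<^bsub>rmod_sum J B\<^esub> matrix_hom I A J B f y"
      using rmod_hom_add[OF row xy] xy S.a_closed[OF xy]
      by (auto simp: matrix_hom_def rmod_sum_simps(2)[of J] intro!: restrict_ext)
  next
    fix x a assume xa: "x \<in> carrier (rmod_sum I A)" "a \<in> carrier R"
    show "matrix_hom I A J B f (x \<lhd>\<^bsub>rmod_sum I A\<^esub> a) = matrix_hom I A J B f x \<lhd>\<^bsub>rmod_sum J B\<^esub> a"
      using rmod_hom_ract[OF row xa] xa right_module.ract_closed[OF S xa]
      by (auto simp: matrix_hom_def rmod_sum_simps(3)[of J] intro!: restrict_ext)
  qed (simp add: matrix_hom_def)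
qed

text \<open>Bijectivity is unique solvability of the linear system given by the matrix.\<close>
lemma matrix_hom_iso:
  assumes "ring R" and I: "finite I" and bij: "bij_betw \<phi> I J"
    and A: "\<And>i. i \<in> I \<Longrightarrow> A i \<in> local_endo_modules R"
    and B: "\<And>j. j \<in> J \<Longrightarrow> B j \<in> local_endo_modules R"
    and f: "\<And>i j. \<lbrakk>i \<in> I; j \<in> J\<rbrakk> \<Longrightarrow> f j i \<in> rmod_hom R (A i) (B j)"
    and iso: "\<And>i j. \<lbrakk>i \<in> I; j \<in> J\<rbrakk> \<Longrightarrow> f j i \<in> rmod_iso R (A i) (B j) \<longleftrightarrow> j = \<phi> i"
  shows "matrix_hom I A J B f \<in> rmod_iso R (rmod_sum I A) (rmod_sum J B)"
proof -
  note A' = A[THEN local_endo_right_module] and B' = B[THEN local_endo_right_module]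
  have J: "finite J" and inj: "inj_on \<phi> I" and image: "\<phi> ` I = J"
    using bij I bij_betw_finite by (auto simp: bij_betw_def)
  have hom: "matrix_hom I A J B f \<in> rmod_hom R (rmod_sum I A) (rmod_sum J B)"
    using matrix_hom_hom[OF assms(1) I A' J B' f] by simp
  have ex1: "\<exists>!x. x \<in> carrier (rmod_sum I A) \<and> matrix_hom I A J B f x = y"
    if y: "y \<in> carrier (rmod_sum J B)" for y
  proof -
    have "x \<in> carrier (rmod_sum I A) \<and> matrix_hom I A J B f x = y \<longleftrightarrow>
        x \<in> (\<Pi>\<^sub>E i\<in>I. carrier (A i)) \<and> (\<forall>j\<in>\<phi> ` I. (\<Oplus>\<^bsub>B j\<^esub>i\<in>I. f j i (x i)) = y j)" for x
    proof -
      have "matrix_hom I A J B f x = y \<longleftrightarrow> (\<forall>j\<in>J. (\<Oplus>\<^bsub>B j\<^esub>i\<in>I. f j i (x i)) = y j)"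
        if "x \<in> carrier (rmod_sum I A)"
        using that y
        by (auto simp: matrix_hom_def rmod_sum_carrier[OF J] fun_eq_iff restrict_def PiE_def extensional_def)
      then show ?thesis unfolding image rmod_sum_carrier[OF I, symmetric] by blast
    qed
    moreover have "\<exists>!x. x \<in> (\<Pi>\<^sub>E i\<in>I. carrier (A i)) \<and> (\<forall>j\<in>\<phi> ` I. (\<Oplus>\<^bsub>B j\<^esub>i\<in>I. f j i (x i)) = y j)"
      by (rule ex1_solution_if_iso_pattern_bijective[OF I inj A])
        (use B f iso rmod_sum_component[OF J y] in \<open>simp_all add: image\<close>)
    ultimately show ?thesis by (simp only:)
  qed
  have "bij_betw (matrix_hom I A J B f) (carrier (rmod_sum I A)) (carrier (rmod_sum J B))"
  proof (rule bij_betw_imageI)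
    show "inj_on (matrix_hom I A J B f) (carrier (rmod_sum I A))"
    proof (rule inj_onI)
      fix x x' assume x: "x \<in> carrier (rmod_sum I A)" and x': "x' \<in> carrier (rmod_sum I A)"
        and "matrix_hom I A J B f x = matrix_hom I A J B f x'"
      then show "x = x'" using ex1[OF rmod_hom_closed[OF hom x]] by auto
    qed
    show "matrix_hom I A J B f ` carrier (rmod_sum I A) = carrier (rmod_sum J B)"
    proof (intro equalityI subsetI)
      fix y assume "y \<in> carrier (rmod_sum J B)"
      from ex1_implies_ex[OF ex1[OF this]]
      show "y \<in> matrix_hom I A J B f ` carrier (rmod_sum I A)" by blast
    qed (use rmod_hom_closed[OF hom] in blast)
  qed
  then show ?thesis using hom by (simp add: rmod_iso_def)
qed

section \<open>The category of homomorphisms\<close>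

lemma Hom_Morph_iff:
  assumes "M \<in> Morph_Mod R"
  shows "u \<in> Hom_Morph R M N \<longleftrightarrow>
    fst u \<in> rmod_hom R (Dom M) (Dom N) \<and> snd u \<in> rmod_hom R (Cod M) (Cod N) \<and>
    (\<forall>x\<in>carrier (Dom M). snd u (arr M x) = arr N (fst u x))"
  by (auto simp: Hom_Morph_def compose_def restrict_def fun_eq_iff)

lemma Hom_Morph_dom: "u \<in> Hom_Morph R M N \<Longrightarrow> fst u \<in> rmod_hom R (Dom M) (Dom N)"
  and Hom_Morph_cod: "u \<in> Hom_Morph R M N \<Longrightarrow> snd u \<in> rmod_hom R (Cod M) (Cod N)"
  by (auto simp: Hom_Morph_def)

lemma Morph_ModD:
  assumes "M \<in> Morph_Mod R"
  shows "right_module R (Dom M)" "right_module R (Cod M)" "arr M \<in> rmod_hom R (Dom M) (Cod M)"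
  using assms by (auto simp: Morph_Mod_def)

lemma Morph_localD:
  assumes "M \<in> Morph_local R"
  shows "M \<in> Morph_Mod R" "Dom M \<in> local_endo_modules R" "Cod M \<in> local_endo_modules R"
  using assms by (auto simp: Morph_local_def)

lemma comp_Morph_Hom:
  assumes M: "M \<in> Morph_Mod R" and N: "N \<in> Morph_Mod R"
    and u: "u \<in> Hom_Morph R M N" and v: "v \<in> Hom_Morph R N P"
  shows "comp_Morph M v u \<in> Hom_Morph R M P"
proof -
  note hom = rmod_hom_compose[OF Morph_ModD(1)[OF M] Hom_Morph_dom[OF u] Hom_Morph_dom[OF v]]
    rmod_hom_compose[OF Morph_ModD(2)[OF M] Hom_Morph_cod[OF u] Hom_Morph_cod[OF v]]
  show ?thesis
    using u v hom rmod_hom_closed[OF Morph_ModD(3)[OF M]] rmod_hom_closed[OF Hom_Morph_dom[OF u]]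
    by (auto simp: Hom_Morph_iff[OF M] Hom_Morph_iff[OF N] comp_Morph_def compose_def)
qed

lemma id_Morph_Hom: "M \<in> Morph_Mod R \<Longrightarrow> id_Morph M \<in> Hom_Morph R M M"
  using Morph_ModD[of M R]
  by (auto simp: Hom_Morph_iff id_Morph_def rmod_hom_id rmod_hom_closed)

lemma zero_Morph_Hom:
  assumes M: "M \<in> Morph_Mod R" and N: "N \<in> Morph_Mod R"
  shows "(hom_zero (Dom M) (Dom N), hom_zero (Cod M) (Cod N)) \<in> Hom_Morph R M N"
proof -
  have "arr N \<zero>\<^bsub>Dom N\<^esub> = \<zero>\<^bsub>Cod N\<^esub>"
    using Morph_ModD[OF N] by (intro rmod_hom_zero right_module_abelian_group)
  then show ?thesis
    using Morph_ModD[OF M] Morph_ModD[OF N]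
    by (simp add: Hom_Morph_iff[OF M] hom_zero_in_rmod_hom)
      (simp add: hom_zero_def rmod_hom_closed)
qed

lemma add_Morph_Hom:
  assumes M: "M \<in> Morph_Mod R" and N: "N \<in> Morph_Mod R"
    and u: "u \<in> Hom_Morph R M N" and v: "v \<in> Hom_Morph R M N"
  shows "(hom_add (Dom M) (Dom N) (fst u) (fst v), hom_add (Cod M) (Cod N) (snd u) (snd v))
    \<in> Hom_Morph R M N"
  using u v Morph_ModD[OF M] Morph_ModD[OF N]
  by (simp add: Hom_Morph_iff[OF M] hom_add_in_rmod_hom)
    (simp add: hom_add_def rmod_hom_closed rmod_hom_add[OF Morph_ModD(3)[OF N]]
      rmod_hom_closed[OF Hom_Morph_dom[OF u]] rmod_hom_closed[OF Hom_Morph_dom[OF v]])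

subsection \<open>Isomorphisms and the two classes\<close>

lemma inverse_Hom_Morph:
  assumes M: "M \<in> Morph_Mod R" and N: "N \<in> Morph_Mod R" and u: "u \<in> Hom_Morph R M N"
    and u\<^sub>0: "fst u \<in> rmod_iso R (Dom M) (Dom N)" and u\<^sub>1: "snd u \<in> rmod_iso R (Cod M) (Cod N)"
  shows "(hom_inv (Dom M) (Dom N) (fst u), hom_inv (Cod M) (Cod N) (snd u)) \<in> Hom_Morph R N M"
proof -
  note inv\<^sub>0 = rmod_iso_hom[OF hom_inv_iso[OF Morph_ModD(1)[OF M] u\<^sub>0]]
    and inv\<^sub>1 = rmod_iso_hom[OF hom_inv_iso[OF Morph_ModD(2)[OF M] u\<^sub>1]]
  have "hom_inv (Cod M) (Cod N) (snd u) (arr N y) = arr M (hom_inv (Dom M) (Dom N) (fst u) y)"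
    if y: "y \<in> carrier (Dom N)" for y
  proof -
    let ?x = "hom_inv (Dom M) (Dom N) (fst u) y"
    have x: "?x \<in> carrier (Dom M)" by (rule rmod_hom_closed[OF inv\<^sub>0 y])
    have "arr N y = snd u (arr M ?x)"
      using u x hom_inv_right[OF u\<^sub>0 y] by (simp add: Hom_Morph_iff[OF M])
    then show ?thesis
      using hom_inv_left[OF u\<^sub>1 rmod_hom_closed[OF Morph_ModD(3)[OF M] x]] by simp
  qed
  then show ?thesis using inv\<^sub>0 inv\<^sub>1 by (simp add: Hom_Morph_iff[OF N])
qed

lemma iso_MorphI:
  assumes M: "M \<in> Morph_Mod R" and N: "N \<in> Morph_Mod R" and u: "u \<in> Hom_Morph R M N"
    and u\<^sub>0: "fst u \<in> rmod_iso R (Dom M) (Dom N)" and u\<^sub>1: "snd u \<in> rmod_iso R (Cod M) (Cod N)"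
  shows "iso_Morph R M N"
proof -
  let ?v = "(hom_inv (Dom M) (Dom N) (fst u), hom_inv (Cod M) (Cod N) (snd u))"
  have "comp_Morph M ?v u = id_Morph M" "comp_Morph N u ?v = id_Morph N"
    by (auto simp: comp_Morph_def id_Morph_def compose_def hom_inv_left[OF u\<^sub>0] hom_inv_left[OF u\<^sub>1]
        hom_inv_right[OF u\<^sub>0] hom_inv_right[OF u\<^sub>1] intro!: restrict_ext)
  then show ?thesis
    using u inverse_Hom_Morph[OF assms] unfolding iso_Morph_def by blast
qed

lemma iso_Morph_sym: "iso_Morph R M N \<Longrightarrow> iso_Morph R N M"
  unfolding iso_Morph_def by blast

lemma same_classes_if_iso_components:
  assumes "M \<in> Morph_Mod R" "N \<in> Morph_Mod R" "u \<in> Hom_Morph R M N"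
    and "fst u \<in> rmod_iso R (Dom M) (Dom N)" "snd u \<in> rmod_iso R (Cod M) (Cod N)"
  shows "same_domain_class R M N" "same_codomain_class R M N"
  using assms(3-) inverse_Hom_Morph[OF assms] hom_inv_iso[OF Morph_ModD(1)[OF assms(1)] assms(4)]
    hom_inv_iso[OF Morph_ModD(2)[OF assms(1)] assms(5)]
  unfolding same_domain_class_def same_codomain_class_def
  by (auto intro!: bexI[of _ u]
      bexI[of _ "(hom_inv (Dom M) (Dom N) (fst u), hom_inv (Cod M) (Cod N) (snd u))"])

lemma
  assumes "M \<in> Morph_Mod R"
  shows same_domain_class_refl: "same_domain_class R M M"
    and same_codomain_class_refl: "same_codomain_class R M M"
  using same_classes_if_iso_components[OF assms assms id_Morph_Hom[OF assms]] Morph_ModD[OF assms]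
  by (simp_all add: id_Morph_def rmod_iso_id)

lemma same_domain_class_sym: "same_domain_class R M N \<Longrightarrow> same_domain_class R N M"
  and same_codomain_class_sym: "same_codomain_class R M N \<Longrightarrow> same_codomain_class R N M"
  unfolding same_domain_class_def same_codomain_class_def by blast+

lemma same_domain_class_trans:
  assumes M: "M \<in> Morph_Mod R" and N: "N \<in> Morph_Mod R" and P: "P \<in> Morph_Mod R"
    and "same_domain_class R M N" "same_domain_class R N P"
  shows "same_domain_class R M P"
proof -
  obtain u u' v v' where uv: "u \<in> Hom_Morph R M N" "u' \<in> Hom_Morph R N M"
    "v \<in> Hom_Morph R N P" "v' \<in> Hom_Morph R P N"
    and iso: "fst u \<in> rmod_iso R (Dom M) (Dom N)" "fst u' \<in> rmod_iso R (Dom N) (Dom M)"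
    "fst v \<in> rmod_iso R (Dom N) (Dom P)" "fst v' \<in> rmod_iso R (Dom P) (Dom N)"
    using assms(4,5) unfolding same_domain_class_def by blast
  show ?thesis
    unfolding same_domain_class_def
    using comp_Morph_Hom[OF M N uv(1,3)] comp_Morph_Hom[OF P N uv(4,2)]
      rmod_iso_compose[OF Morph_ModD(1)[OF M] iso(1,3)] rmod_iso_compose[OF Morph_ModD(1)[OF P] iso(4,2)]
    by (intro bexI[of _ "comp_Morph M v u"] bexI[of _ "comp_Morph P u' v'"])
      (simp_all add: comp_Morph_def)
qed

lemma same_codomain_class_trans:
  assumes M: "M \<in> Morph_Mod R" and N: "N \<in> Morph_Mod R" and P: "P \<in> Morph_Mod R"
    and "same_codomain_class R M N" "same_codomain_class R N P"
  shows "same_codomain_class R M P"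
proof -
  obtain u u' v v' where uv: "u \<in> Hom_Morph R M N" "u' \<in> Hom_Morph R N M"
    "v \<in> Hom_Morph R N P" "v' \<in> Hom_Morph R P N"
    and iso: "snd u \<in> rmod_iso R (Cod M) (Cod N)" "snd u' \<in> rmod_iso R (Cod N) (Cod M)"
    "snd v \<in> rmod_iso R (Cod N) (Cod P)" "snd v' \<in> rmod_iso R (Cod P) (Cod N)"
    using assms(4,5) unfolding same_codomain_class_def by blast
  show ?thesis
    unfolding same_codomain_class_def
    using comp_Morph_Hom[OF M N uv(1,3)] comp_Morph_Hom[OF P N uv(4,2)]
      rmod_iso_compose[OF Morph_ModD(2)[OF M] iso(1,3)] rmod_iso_compose[OF Morph_ModD(2)[OF P] iso(4,2)]
    by (intro bexI[of _ "comp_Morph M v u"] bexI[of _ "comp_Morph P u' v'"])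
      (simp_all add: comp_Morph_def)
qed

text \<open>Let \<open>d\<close> be invertible on domains and \<open>c\<close> on codomains.  Unless one of them is already
  an isomorphism, \<open>c\<close> is non-invertible on domains and \<open>d\<close> on codomains; then \<open>d + c\<close> is
  an isomorphism, because non-invertible homomorphisms are negligible in sums.\<close>
lemma iso_components_if_same_classes:
  assumes M: "M \<in> Morph_local R" and N: "N \<in> Morph_local R"
    and D: "same_domain_class R M N" and C: "same_codomain_class R M N"
  shows "\<exists>w\<in>Hom_Morph R M N. fst w \<in> rmod_iso R (Dom M) (Dom N) \<and> snd w \<in> rmod_iso R (Cod M) (Cod N)"
proof -
  note M' = Morph_localD[OF M] and N' = Morph_localD[OF N]
  obtain d where d: "d \<in> Hom_Morph R M N" "fst d \<in> rmod_iso R (Dom M) (Dom N)"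
    using D unfolding same_domain_class_def by blast
  obtain c where c: "c \<in> Hom_Morph R M N" "snd c \<in> rmod_iso R (Cod M) (Cod N)"
    using C unfolding same_codomain_class_def by blast
  show ?thesis
  proof (cases "snd d \<in> rmod_iso R (Cod M) (Cod N) \<or> fst c \<in> rmod_iso R (Dom M) (Dom N)")
    case True
    then show ?thesis using c d by blast
  next
    case False
    let ?w = "(hom_add (Dom M) (Dom N) (fst d) (fst c), hom_add (Cod M) (Cod N) (snd d) (snd c))"
    have "?w \<in> Hom_Morph R M N" by (rule add_Morph_Hom[OF M'(1) N'(1) d(1) c(1)])
    moreover have "fst ?w \<in> rmod_iso R (Dom M) (Dom N)"
      using hom_add_iso_iff[OF M'(2) Morph_ModD(1)[OF N'(1)] Hom_Morph_dom[OF d(1)] Hom_Morph_dom[OF c(1)]]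
        False d(2) by simp
    moreover have "snd ?w \<in> rmod_iso R (Cod M) (Cod N)"
      using hom_add_iso_iff[OF M'(3) Morph_ModD(2)[OF N'(1)] Hom_Morph_cod[OF c(1)] Hom_Morph_cod[OF d(1)]]
        hom_add_comm[OF Morph_ModD(2)[OF N'(1)] Hom_Morph_cod[OF c(1)] Hom_Morph_cod[OF d(1)]]
        False c(2) by simp
    ultimately show ?thesis by blast
  qed
qed

subsection \<open>Direct sums in the category\<close>

lemma sum_Morph_simps:
  "Dom (sum_Morph I M) = rmod_sum I (\<lambda>i. Dom (M i))"
  "Cod (sum_Morph I M) = rmod_sum I (\<lambda>i. Cod (M i))"
  "arr (sum_Morph I M) = (\<lambda>x\<in>carrier (rmod_sum I (\<lambda>i. Dom (M i))). \<lambda>i\<in>I. arr (M i) (x i))"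
  by (simp_all add: sum_Morph_def)

lemma sum_Morph_Morph_Mod:
  assumes "ring R" and I: "finite I" and M: "\<And>i. i \<in> I \<Longrightarrow> M i \<in> Morph_Mod R"
  shows "sum_Morph I M \<in> Morph_Mod R"
proof -
  note M' = Morph_ModD[OF M]
  have dom: "right_module R (rmod_sum I (\<lambda>i. Dom (M i)))"
    and cod: "right_module R (rmod_sum I (\<lambda>i. Cod (M i)))"
    using M' assms by (simp_all add: rmod_sum_right_module)
  have xi: "x i \<in> carrier (Dom (M i))" if "x \<in> carrier (rmod_sum I (\<lambda>i. Dom (M i)))" "i \<in> I" for x i
    using rmod_sum_component[OF I that] .
  have "arr (sum_Morph I M) \<in> rmod_hom R (rmod_sum I (\<lambda>i. Dom (M i))) (rmod_sum I (\<lambda>i. Cod (M i)))"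
    using abelian_groupE(1)[OF right_module_abelian_group[OF dom]] right_module.ract_closed[OF dom]
    by (intro rmod_homI)
      (auto simp: sum_Morph_simps rmod_sum_carrier[OF I, of "\<lambda>i. Cod (M i)"] rmod_sum_simps
        rmod_hom_closed[OF M'(3)] rmod_hom_add[OF M'(3)] rmod_hom_ract[OF M'(3)] xi intro!: restrict_ext)
  then show ?thesis using dom cod by (simp add: Morph_Mod_def sum_Morph_simps)
qed

lemma entry_Hom_Morph:
  assumes R: "ring R" and I: "finite I" and M: "\<And>i. i \<in> I \<Longrightarrow> M i \<in> Morph_Mod R"
    and J: "finite J" and N: "\<And>j. j \<in> J \<Longrightarrow> N j \<in> Morph_Mod R"
    and u: "u \<in> Hom_Morph R (sum_Morph I M) (sum_Morph J N)" and i: "i \<in> I" and j: "j \<in> J"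
  shows "(hom_entry I (\<lambda>i. Dom (M i)) J (\<lambda>j. Dom (N j)) (fst u) j i,
    hom_entry I (\<lambda>i. Cod (M i)) J (\<lambda>j. Cod (N j)) (snd u) j i) \<in> Hom_Morph R (M i) (N j)"
proof -
  note M' = Morph_ModD[OF M] and N' = Morph_ModD[OF N]
  have sumM: "sum_Morph I M \<in> Morph_Mod R" using sum_Morph_Morph_Mod[OF R I M] by simp
  have u\<^sub>0: "fst u \<in> rmod_hom R (rmod_sum I (\<lambda>i. Dom (M i))) (rmod_sum J (\<lambda>j. Dom (N j)))"
    and u\<^sub>1: "snd u \<in> rmod_hom R (rmod_sum I (\<lambda>i. Cod (M i))) (rmod_sum J (\<lambda>j. Cod (N j)))"
    using Hom_Morph_dom[OF u] Hom_Morph_cod[OF u] by (simp_all add: sum_Morph_simps(1,2))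
  have hom\<^sub>0: "hom_entry I (\<lambda>i. Dom (M i)) J (\<lambda>j. Dom (N j)) (fst u) j i \<in> rmod_hom R (Dom (M i)) (Dom (N j))"
    and hom\<^sub>1: "hom_entry I (\<lambda>i. Cod (M i)) J (\<lambda>j. Cod (N j)) (snd u) j i \<in> rmod_hom R (Cod (M i)) (Cod (N j))"
    using hom_entry_hom[OF R I _ J _ u\<^sub>0 i j] hom_entry_hom[OF R I _ J _ u\<^sub>1 i j] M' N' by simp_all
  have "hom_entry I (\<lambda>i. Cod (M i)) J (\<lambda>j. Cod (N j)) (snd u) j i (arr (M i) x)
      = arr (N j) (hom_entry I (\<lambda>i. Dom (M i)) J (\<lambda>j. Dom (N j)) (fst u) j i x)"
    if x: "x \<in> carrier (Dom (M i))" for x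
  proof -
    let ?x = "sum_inj I (\<lambda>i. Dom (M i)) i x"
    have inj\<^sub>0: "sum_inj I (\<lambda>i. Dom (M i)) i \<in> rmod_hom R (Dom (M i)) (rmod_sum I (\<lambda>i. Dom (M i)))"
      and inj\<^sub>1: "sum_inj I (\<lambda>i. Cod (M i)) i \<in> rmod_hom R (Cod (M i)) (rmod_sum I (\<lambda>i. Cod (M i)))"
      using sum_inj_hom[where A = "\<lambda>i. Dom (M i)", OF I] sum_inj_hom[where A = "\<lambda>i. Cod (M i)", OF I] M' i
      by simp_all
    have ix: "?x \<in> carrier (rmod_sum I (\<lambda>i. Dom (M i)))" by (rule rmod_hom_closed[OF inj\<^sub>0 x])
    have ux: "fst u ?x \<in> carrier (rmod_sum J (\<lambda>j. Dom (N j)))"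
      by (rule rmod_hom_closed[OF u\<^sub>0 ix])
    have ax: "arr (M i) x \<in> carrier (Cod (M i))" by (rule rmod_hom_closed[OF M'(3)[OF i] x])
    have arr0: "arr (M k) \<zero>\<^bsub>Dom (M k)\<^esub> = \<zero>\<^bsub>Cod (M k)\<^esub>" if "k \<in> I" for k
      using M'[OF that] by (intro rmod_hom_zero right_module_abelian_group)
    have "sum_inj I (\<lambda>i. Cod (M i)) i (arr (M i) x) = arr (sum_Morph I M) ?x"
      using x ax ix by (auto simp: sum_inj_def sum_Morph_simps arr0 intro!: restrict_ext)
    then have "snd u (sum_inj I (\<lambda>i. Cod (M i)) i (arr (M i) x)) = arr (sum_Morph J N) (fst u ?x)"
      using u ix by (simp add: Hom_Morph_iff[OF sumM] sum_Morph_simps(1))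
    moreover have "snd u (sum_inj I (\<lambda>i. Cod (M i)) i (arr (M i) x)) \<in> carrier (rmod_sum J (\<lambda>j. Cod (N j)))"
      by (rule rmod_hom_closed[OF u\<^sub>1 rmod_hom_closed[OF inj\<^sub>1 ax]])
    ultimately show ?thesis
      using x ax ux j by (simp add: hom_entry_def compose_def sum_proj_def sum_Morph_simps)
  qed
  then show ?thesis using hom\<^sub>0 hom\<^sub>1 by (simp add: Hom_Morph_iff[OF M[OF i]])
qed

lemma matrix_Hom_Morph:
  assumes R: "ring R" and I: "finite I" and M: "\<And>i. i \<in> I \<Longrightarrow> M i \<in> Morph_Mod R"
    and J: "finite J" and N: "\<And>j. j \<in> J \<Longrightarrow> N j \<in> Morph_Mod R"
    and w: "\<And>i j. \<lbrakk>i \<in> I; j \<in> J\<rbrakk> \<Longrightarrow> w j i \<in> Hom_Morph R (M i) (N j)"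
  shows "(matrix_hom I (\<lambda>i. Dom (M i)) J (\<lambda>j. Dom (N j)) (\<lambda>j i. fst (w j i)),
    matrix_hom I (\<lambda>i. Cod (M i)) J (\<lambda>j. Cod (N j)) (\<lambda>j i. snd (w j i)))
    \<in> Hom_Morph R (sum_Morph I M) (sum_Morph J N)"
proof -
  note M' = Morph_ModD[OF M] and N' = Morph_ModD[OF N]
  let ?f\<^sub>0 = "matrix_hom I (\<lambda>i. Dom (M i)) J (\<lambda>j. Dom (N j)) (\<lambda>j i. fst (w j i))"
    and ?f\<^sub>1 = "matrix_hom I (\<lambda>i. Cod (M i)) J (\<lambda>j. Cod (N j)) (\<lambda>j i. snd (w j i))"
  note w\<^sub>0 = Hom_Morph_dom[OF w] and w\<^sub>1 = Hom_Morph_cod[OF w]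
  have hom\<^sub>0: "?f\<^sub>0 \<in> rmod_hom R (rmod_sum I (\<lambda>i. Dom (M i))) (rmod_sum J (\<lambda>j. Dom (N j)))"
    and hom\<^sub>1: "?f\<^sub>1 \<in> rmod_hom R (rmod_sum I (\<lambda>i. Cod (M i))) (rmod_sum J (\<lambda>j. Cod (N j)))"
    using M' N' w\<^sub>0 w\<^sub>1
      matrix_hom_hom[where A = "\<lambda>i. Dom (M i)" and B = "\<lambda>j. Dom (N j)" and f = "\<lambda>j i. fst (w j i)", OF R I _ J]
      matrix_hom_hom[where A = "\<lambda>i. Cod (M i)" and B = "\<lambda>j. Cod (N j)" and f = "\<lambda>j i. snd (w j i)", OF R I _ J]
    by simp_all
  have sumM: "sum_Morph I M \<in> Morph_Mod R" using sum_Morph_Morph_Mod[OF R I M] by simp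
  have "?f\<^sub>1 (arr (sum_Morph I M) x) = arr (sum_Morph J N) (?f\<^sub>0 x)"
    if x: "x \<in> carrier (rmod_sum I (\<lambda>i. Dom (M i)))" for x
  proof -
    have xi: "x i \<in> carrier (Dom (M i))" if "i \<in> I" for i using rmod_sum_component[OF I x that] .
    have ax: "arr (sum_Morph I M) x \<in> carrier (rmod_sum I (\<lambda>i. Cod (M i)))"
      using rmod_hom_closed[OF Morph_ModD(3)[OF sumM]] x by (simp add: sum_Morph_simps(1,2))
    have "(\<Oplus>\<^bsub>Cod (N j)\<^esub>i\<in>I. snd (w j i) (arr (M i) (x i)))
        = arr (N j) (\<Oplus>\<^bsub>Dom (N j)\<^esub>i\<in>I. fst (w j i) (x i))" if j: "j \<in> J" for j
    proof -
      interpret C: abelian_group "Cod (N j)" using N'(2)[OF j] by (rule right_module_abelian_group)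
      have wx: "fst (w j i) (x i) \<in> carrier (Dom (N j))" if "i \<in> I" for i
        by (rule rmod_hom_closed[OF w\<^sub>0[OF that j] xi[OF that]])
      have "(\<Oplus>\<^bsub>Cod (N j)\<^esub>i\<in>I. snd (w j i) (arr (M i) (x i)))
          = (\<Oplus>\<^bsub>Cod (N j)\<^esub>i\<in>I. arr (N j) (fst (w j i) (x i)))"
        by (rule C.finsum_cong')
          (use w[OF _ j] xi wx rmod_hom_closed[OF N'(3)[OF j]] in \<open>auto simp: Hom_Morph_iff[OF M]\<close>)
      also have "\<dots> = arr (N j) (\<Oplus>\<^bsub>Dom (N j)\<^esub>i\<in>I. fst (w j i) (x i))"
        by (rule rmod_hom_finsum[OF right_module_abelian_group[OF N'(1)[OF j]] C.abelian_group_axioms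
              N'(3)[OF j] I wx, symmetric])
      finally show ?thesis .
    qed
    moreover have "?f\<^sub>1 (arr (sum_Morph I M) x)
        = (\<lambda>j\<in>J. \<Oplus>\<^bsub>Cod (N j)\<^esub>i\<in>I. snd (w j i) (arr (sum_Morph I M) x i))"
      using ax by (simp add: matrix_hom_def)
    moreover have "\<dots> = (\<lambda>j\<in>J. \<Oplus>\<^bsub>Cod (N j)\<^esub>i\<in>I. snd (w j i) (arr (M i) (x i)))"
    proof (rule restrict_ext)
      fix j assume j: "j \<in> J"
      interpret C: abelian_group "Cod (N j)" using N'(2)[OF j] by (rule right_module_abelian_group)
      show "(\<Oplus>\<^bsub>Cod (N j)\<^esub>i\<in>I. snd (w j i) (arr (sum_Morph I M) x i))
          = (\<Oplus>\<^bsub>Cod (N j)\<^esub>i\<in>I. snd (w j i) (arr (M i) (x i)))"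
        by (rule C.finsum_cong')
          (use x xi in \<open>auto simp: sum_Morph_simps intro: rmod_hom_closed[OF w\<^sub>1[OF _ j]] rmod_hom_closed[OF M'(3)]\<close>)
    qed
    ultimately show ?thesis
      using x rmod_hom_closed[OF hom\<^sub>0 x]
      by (auto simp: sum_Morph_simps(3)[of J] intro!: restrict_ext) (simp add: matrix_hom_def)
  qed
  then show ?thesis
    using hom\<^sub>0 hom\<^sub>1 by (simp add: Hom_Morph_iff[OF sumM] sum_Morph_simps(1,2))
qed

section \<open>Isomorphic sums have the same classes\<close>

lemma hom_sum_split:
  assumes "right_module R B" and "finite L" and "X \<subseteq> L"
    and f: "\<And>l. l \<in> L \<Longrightarrow> f l \<in> rmod_hom R A B"
  shows "hom_sum A B L f = hom_add A B (hom_sum A B X f) (hom_sum A B (L - X) f)"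
proof -
  interpret B: abelian_group B using assms(1) by (rule right_module_abelian_group)
  have fin: "finite X" "finite (L - X)" using assms(2,3) finite_subset by auto
  have "(\<Oplus>\<^bsub>B\<^esub>l\<in>X \<union> (L - X). f l x) = (\<Oplus>\<^bsub>B\<^esub>l\<in>X. f l x) \<oplus>\<^bsub>B\<^esub> (\<Oplus>\<^bsub>B\<^esub>l\<in>L - X. f l x)"
    if "x \<in> carrier A" for x
    by (rule B.finsum_Un_disjoint[OF fin])
      (use assms(3) that rmod_hom_closed[OF f] in auto)
  moreover have "X \<union> (L - X) = L" using assms(3) by blast
  ultimately show ?thesis by (auto simp: hom_sum_def hom_add_def intro!: restrict_ext)
qed

text \<open>Split \<open>u (\<iota> x)\<close>, where \<open>\<iota>\<close> is the embedding of \<open>A k'\<close>, into its components in the \<open>B l\<close>; additivity of \<open>v\<close>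
  recovers \<open>v (u (\<iota> x)) = \<iota> x\<close> from the entries.\<close>
lemma hom_entry_product:
  assumes R: "ring R" and K: "finite K" and A: "\<And>k. k \<in> K \<Longrightarrow> right_module R (A k)"
    and L: "finite L" and B: "\<And>l. l \<in> L \<Longrightarrow> right_module R (B l)"
    and u: "u \<in> rmod_hom R (rmod_sum K A) (rmod_sum L B)"
    and v: "v \<in> rmod_hom R (rmod_sum L B) (rmod_sum K A)"
    and vu: "\<And>x. x \<in> carrier (rmod_sum K A) \<Longrightarrow> v (u x) = x"
    and k: "k \<in> K" and k': "k' \<in> K"
  shows "hom_sum (A k') (A k) L
      (\<lambda>l. compose (carrier (A k')) (hom_entry L B K A v k l) (hom_entry K A L B u l k'))
    = (if k = k' then \<lambda>x\<in>carrier (A k'). x else hom_zero (A k') (A k))"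
proof -
  let ?h = "compose (carrier (rmod_sum L B)) (sum_proj K A k) v"
  have inj: "sum_inj K A k' \<in> rmod_hom R (A k') (rmod_sum K A)"
    using sum_inj_hom[where A = A, OF K A k'] by simp
  have proj: "sum_proj K A k \<in> rmod_hom R (rmod_sum K A) (A k)"
    using sum_proj_hom[where A = A, OF R K A k] by simp
  have S: "right_module R (rmod_sum L B)" using rmod_sum_right_module[OF R L B] by simp
  have h: "?h \<in> rmod_hom R (rmod_sum L B) (A k)" by (rule rmod_hom_compose[OF S v proj])
  have main: "(\<Oplus>\<^bsub>A k\<^esub>l\<in>L. hom_entry L B K A v k l (hom_entry K A L B u l k' x))
      = (if k = k' then x else \<zero>\<^bsub>A k\<^esub>)" if x: "x \<in> carrier (A k')" for x
  proof -
    interpret Ak: abelian_group "A k" using A[OF k] by (rule right_module_abelian_group)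
    let ?x = "sum_inj K A k' x"
    have ix: "?x \<in> carrier (rmod_sum K A)" by (rule rmod_hom_closed[OF inj x])
    have ux: "u ?x \<in> carrier (rmod_sum L B)" by (rule rmod_hom_closed[OF u ix])
    have ul: "u ?x l \<in> carrier (B l)" if "l \<in> L" for l using rmod_sum_component[OF L ux that] .
    have il: "sum_inj L B l (u ?x l) \<in> carrier (rmod_sum L B)" if "l \<in> L" for l
      using rmod_hom_closed[OF sum_inj_hom[where A = B and R = R, OF L _ that] ul[OF that]] B by simp
    have "(\<Oplus>\<^bsub>A k\<^esub>l\<in>L. hom_entry L B K A v k l (hom_entry K A L B u l k' x))
        = (\<Oplus>\<^bsub>A k\<^esub>l\<in>L. ?h (sum_inj L B l (u ?x l)))"
    proof (rule Ak.finsum_cong')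
      show "(\<lambda>l. ?h (sum_inj L B l (u ?x l))) \<in> L \<rightarrow> carrier (A k)"
        using rmod_hom_closed[OF h il] by blast
      fix l assume l: "l \<in> L"
      have "hom_entry K A L B u l k' x = u ?x l"
        using x ux by (simp add: hom_entry_def compose_def sum_proj_def)
      then show "hom_entry L B K A v k l (hom_entry K A L B u l k' x) = ?h (sum_inj L B l (u ?x l))"
        using ul[OF l] il[OF l] by (simp add: hom_entry_def compose_def)
    qed simp
    also have "\<dots> = ?h (u ?x)"
      using hom_rmod_sum_decompose[OF R L B A[OF k] h ux] by simp
    also have "\<dots> = ?x k" using ux ix vu[OF ix] by (simp add: compose_def sum_proj_def)
    also have "\<dots> = (if k = k' then x else \<zero>\<^bsub>A k\<^esub>)" using x k by (simp add: sum_inj_def)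
    finally show ?thesis .
  qed
  have "hom_sum (A k') (A k) L
      (\<lambda>l. compose (carrier (A k')) (hom_entry L B K A v k l) (hom_entry K A L B u l k'))
    = (\<lambda>x\<in>carrier (A k'). if k = k' then x else \<zero>\<^bsub>A k\<^esub>)"
    unfolding hom_sum_def by (rule restrict_ext) (simp add: compose_def main)
  then show ?thesis by (simp add: hom_zero_def)
qed

lemma injection_preserving_labels:
  assumes K: "finite K" and L: "finite L"
    and card_le: "\<And>c. c \<in> \<gamma> ` K \<Longrightarrow> card {k \<in> K. \<gamma> k = c} \<le> card {l \<in> L. \<delta> l = c}"
  shows "\<exists>g. inj_on g K \<and> g ` K \<subseteq> L \<and> (\<forall>k\<in>K. \<delta> (g k) = \<gamma> k)"
proof -
  have "\<forall>c\<in>\<gamma> ` K. \<exists>f. f ` {k \<in> K. \<gamma> k = c} \<subseteq> {l \<in> L. \<delta> l = c} \<and> inj_on f {k \<in> K. \<gamma> k = c}"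
    using K L card_le by (simp add: card_le_inj)
  from bchoice[OF this] obtain f
    where f: "\<And>c. c \<in> \<gamma> ` K \<Longrightarrow> f c ` {k \<in> K. \<gamma> k = c} \<subseteq> {l \<in> L. \<delta> l = c}"
      and inj: "\<And>c. c \<in> \<gamma> ` K \<Longrightarrow> inj_on (f c) {k \<in> K. \<gamma> k = c}"
    by blast
  have g: "f (\<gamma> k) k \<in> L" "\<delta> (f (\<gamma> k) k) = \<gamma> k" if "k \<in> K" for k
    using f[of "\<gamma> k"] that by auto
  have "inj_on (\<lambda>k. f (\<gamma> k) k) K"
  proof (rule inj_onI)
    fix k k' assume "k \<in> K" "k' \<in> K" "f (\<gamma> k) k = f (\<gamma> k') k'"
    moreover from this have "\<gamma> k = \<gamma> k'" using g(2) by metis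
    ultimately show "k = k'" using inj[of "\<gamma> k"] by (auto dest: inj_onD)
  qed
  then show ?thesis using g by blast
qed

text \<open>The labels stand for the domain or codomain classes of the summands.  Fix a label \<open>c\<close> and restrict the
  matrices \<open>U\<close>, \<open>V\<close> of \<open>u\<close>, \<open>v\<close> to the indices labelled \<open>c\<close>.  The indices \<open>l\<close> that are dropped
  contribute only non-invertible products \<open>V\<^bsub>k l\<^esub> U\<^bsub>l k'\<^esub>\<close>, so the restricted product keeps the invertible
  entries of \<open>V U = 1\<close>, and \<open>card_le_if_product_iso_diagonal\<close> compares the numbers of indices labelled \<open>c\<close>.  The argument cannot
  be run on all indices at once: for mutually inverse matrices, even over a field, there need not be a permutation
  along which the entries of both are nonzero.\<close>
lemma label_preserving_injection_of_iso:
  fixes \<gamma> :: "'k \<Rightarrow> 'c"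
  assumes R: "ring R" and K: "finite K" and A: "\<And>k. k \<in> K \<Longrightarrow> A k \<in> local_endo_modules R"
    and L: "finite L" and B: "\<And>l. l \<in> L \<Longrightarrow> B l \<in> local_endo_modules R"
    and u: "u \<in> rmod_hom R (rmod_sum K A) (rmod_sum L B)"
    and v: "v \<in> rmod_hom R (rmod_sum L B) (rmod_sum K A)"
    and vu: "\<And>x. x \<in> carrier (rmod_sum K A) \<Longrightarrow> v (u x) = x"
    and labels: "\<And>k k' l. \<lbrakk>k \<in> K; k' \<in> K; l \<in> L; \<gamma> k = \<gamma> k';
      hom_entry K A L B u l k' \<in> rmod_iso R (A k') (B l);
      hom_entry L B K A v k l \<in> rmod_iso R (B l) (A k)\<rbrakk> \<Longrightarrow> \<delta> l = \<gamma> k"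
  shows "\<exists>g. inj_on g K \<and> g ` K \<subseteq> L \<and> (\<forall>k\<in>K. \<delta> (g k) = \<gamma> k)"
proof (rule injection_preserving_labels[OF K L])
  note A' = A[THEN local_endo_right_module] and B' = B[THEN local_endo_right_module]
  let ?U = "hom_entry K A L B u" and ?V = "hom_entry L B K A v"
  fix c
  let ?K = "{k \<in> K. \<gamma> k = c}" and ?L = "{l \<in> L. \<delta> l = c}"
  have U: "?U l k \<in> rmod_hom R (A k) (B l)" and V: "?V k l \<in> rmod_hom R (B l) (A k)"
    if "k \<in> K" "l \<in> L" for k l
    using hom_entry_hom[OF R K A' L B' u that] hom_entry_hom[OF R L B' K A' v that(2,1)] by simp_all
  show "card ?K \<le> card ?L"
  proof (rule card_le_if_product_iso_diagonal[where A = A and B = B and U = ?U and V = ?V])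
    fix k k' assume "k \<in> ?K" "k' \<in> ?K"
    then have k: "k \<in> K" and k': "k' \<in> K" and c: "\<gamma> k = c" "\<gamma> k' = c" by auto
    let ?p = "\<lambda>l. compose (carrier (A k')) (?V k l) (?U l k')"
    have p: "?p l \<in> rmod_hom R (A k') (A k)" if "l \<in> L" for l
      by (rule rmod_hom_compose[OF A'[OF k'] U[OF k' that] V[OF k that]])
    have part: "hom_sum (A k') (A k) X ?p \<in> rmod_hom R (A k') (A k)" if "X \<subseteq> L" for X
      using that p finite_subset[OF that L] by (intro hom_sum_in_rmod_hom A' k k') auto
    have "?p l \<notin> rmod_iso R (A k') (A k)" if "l \<in> L - ?L" for l
      using that labels[OF k k', of l] c compose_iso_iff[OF A[OF k'] B A'[OF k] U[OF k'] V[OF k], of l]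
      by auto
    then have rest: "hom_sum (A k') (A k) (L - ?L) ?p \<notin> rmod_iso R (A k') (A k)"
      using hom_sum_isoD[OF A[OF k'] A'[OF k], of "L - ?L" ?p] p L by blast
    have "hom_sum (A k') (A k) L ?p = (if k = k' then \<lambda>x\<in>carrier (A k'). x else hom_zero (A k') (A k))"
      using hom_entry_product[OF R K A' L B' u v vu k k'] by simp
    then have "hom_sum (A k') (A k) L ?p \<in> rmod_iso R (A k') (A k) \<longleftrightarrow> k = k'"
      using rmod_iso_id[OF A'[OF k]] hom_zero_not_iso[OF A[OF k'], of "A k"] by auto
    moreover have "hom_sum (A k') (A k) L ?p
        = hom_add (A k') (A k) (hom_sum (A k') (A k) ?L ?p) (hom_sum (A k') (A k) (L - ?L) ?p)"
      using p by (intro hom_sum_split[OF A'[OF k] L]) auto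
    ultimately show "hom_sum (A k') (A k) ?L ?p \<in> rmod_iso R (A k') (A k) \<longleftrightarrow> k = k'"
      using hom_add_iso_iff[OF A[OF k'] A'[OF k] part part rest] by auto
  qed (use K L A B U V in auto)
qed

context
  fixes R :: "'r ring" and K :: "'k set" and L :: "'l set"
    and M :: "'k \<Rightarrow> ('r, 'a, 'b) mor_obj" and N :: "'l \<Rightarrow> ('r, 'c, 'd) mor_obj"
  assumes R: "ring R" and K: "finite K" and L: "finite L"
    and M: "\<And>k. k \<in> K \<Longrightarrow> M k \<in> Morph_local R" and N: "\<And>l. l \<in> L \<Longrightarrow> N l \<in> Morph_local R"
    and iso: "iso_Morph R (sum_Morph K M) (sum_Morph L N)"
begin

text \<open>If \<open>V\<^bsub>k l\<^esub>\<close> and \<open>U\<^bsub>l k'\<^esub>\<close> are invertible on domains and \<open>M k\<close>, \<open>M k'\<close> have the same domain class,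
  then \<open>M k \<rightarrow> M k' \<rightarrow> N l \<rightarrow> M k\<close> consists of morphisms that are invertible on domains, so
  \<open>N l\<close> has that class as well.\<close>
lemma domain_class_preserving_injection:
  "\<exists>g. inj_on g K \<and> g ` K \<subseteq> L \<and> (\<forall>k\<in>K. same_domain_class R (M k) (N (g k)))"
proof -
  note M' = Morph_localD[OF M] and N' = Morph_localD[OF N]
  obtain u v where u: "u \<in> Hom_Morph R (sum_Morph K M) (sum_Morph L N)"
    and v: "v \<in> Hom_Morph R (sum_Morph L N) (sum_Morph K M)"
    and vu: "comp_Morph (sum_Morph K M) v u = id_Morph (sum_Morph K M)"
    using iso unfolding iso_Morph_def by blast
  let ?A = "\<lambda>k. Dom (M k)" and ?B = "\<lambda>l. Dom (N l)"
  \<comment> \<open>A class is recorded as the set of those indices in \<open>K\<close> whose summand belongs to it, so that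
    objects of different types can carry the same label.\<close>
  define \<gamma> where "\<gamma> k = {j \<in> K. same_domain_class R (M k) (M j)}" for k
  define \<delta> where "\<delta> l = {j \<in> K. same_domain_class R (N l) (M j)}" for l
  have "\<exists>g. inj_on g K \<and> g ` K \<subseteq> L \<and> (\<forall>k\<in>K. \<delta> (g k) = \<gamma> k)"
  proof (rule label_preserving_injection_of_iso[where A = ?A and B = ?B and u = "fst u" and v = "fst v",
        OF R K M'(2) L N'(2)])
    show "fst u \<in> rmod_hom R (rmod_sum K ?A) (rmod_sum L ?B)"
      and "fst v \<in> rmod_hom R (rmod_sum L ?B) (rmod_sum K ?A)"
      using Hom_Morph_dom[OF u] Hom_Morph_dom[OF v] by (simp_all add: sum_Morph_simps(1))
    show "fst v (fst u x) = x" if "x \<in> carrier (rmod_sum K ?A)" for x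
      using fun_cong[OF arg_cong[OF vu, of fst], of x] that
      by (simp add: comp_Morph_def id_Morph_def compose_def sum_Morph_simps)
  next
    fix k k' l assume k: "k \<in> K" and k': "k' \<in> K" and l: "l \<in> L" and "\<gamma> k = \<gamma> k'"
      and U: "hom_entry K ?A L ?B (fst u) l k' \<in> rmod_iso R (?A k') (?B l)"
      and V: "hom_entry L ?B K ?A (fst v) k l \<in> rmod_iso R (?B l) (?A k)"
    moreover have "k' \<in> \<gamma> k'" using k' same_domain_class_refl[OF M'(1)] by (simp add: \<gamma>_def)
    ultimately have "k' \<in> \<gamma> k" by simp
    then have kk': "same_domain_class R (M k) (M k')" by (simp add: \<gamma>_def)
    then obtain w where w: "w \<in> Hom_Morph R (M k) (M k')" "fst w \<in> rmod_iso R (?A k) (?A k')"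
      unfolding same_domain_class_def by blast
    obtain u' where u': "u' \<in> Hom_Morph R (M k') (N l)" "fst u' \<in> rmod_iso R (?A k') (?B l)"
      using entry_Hom_Morph[OF R K M'(1) L N'(1) u k' l] U by (metis fst_conv)
    obtain v' where v': "v' \<in> Hom_Morph R (N l) (M k)" "fst v' \<in> rmod_iso R (?B l) (?A k)"
      using entry_Hom_Morph[OF R L N'(1) K M'(1) v l k] V by (metis fst_conv)
    have "fst (comp_Morph (M k) u' w) \<in> rmod_iso R (?A k) (?B l)"
      using rmod_iso_compose[OF Morph_ModD(1)[OF M'(1)[OF k]] w(2) u'(2)] by (simp add: comp_Morph_def)
    then have kl: "same_domain_class R (M k) (N l)"
      using comp_Morph_Hom[OF M'(1)[OF k] M'(1)[OF k'] w(1) u'(1)] v'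
      unfolding same_domain_class_def by blast
    then show "\<delta> l = \<gamma> k"
      unfolding \<delta>_def \<gamma>_def using M'(1) N'(1) k l
      by (meson same_domain_class_sym same_domain_class_trans)
  qed
  then obtain g where g: "inj_on g K" "g ` K \<subseteq> L" "\<And>k. k \<in> K \<Longrightarrow> \<delta> (g k) = \<gamma> k" by blast
  have "same_domain_class R (M k) (N (g k))" if k: "k \<in> K" for k
  proof -
    have "k \<in> \<delta> (g k)" unfolding g(3)[OF k] using k same_domain_class_refl[OF M'(1)] by (simp add: \<gamma>_def)
    then show ?thesis by (simp add: \<delta>_def same_domain_class_sym)
  qed
  then show ?thesis using g by blast
qed

lemma codomain_class_preserving_injection:
  "\<exists>g. inj_on g K \<and> g ` K \<subseteq> L \<and> (\<forall>k\<in>K. same_codomain_class R (M k) (N (g k)))"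
proof -
  note M' = Morph_localD[OF M] and N' = Morph_localD[OF N]
  obtain u v where u: "u \<in> Hom_Morph R (sum_Morph K M) (sum_Morph L N)"
    and v: "v \<in> Hom_Morph R (sum_Morph L N) (sum_Morph K M)"
    and vu: "comp_Morph (sum_Morph K M) v u = id_Morph (sum_Morph K M)"
    using iso unfolding iso_Morph_def by blast
  let ?A = "\<lambda>k. Cod (M k)" and ?B = "\<lambda>l. Cod (N l)"
  define \<gamma> where "\<gamma> k = {j \<in> K. same_codomain_class R (M k) (M j)}" for k
  define \<delta> where "\<delta> l = {j \<in> K. same_codomain_class R (N l) (M j)}" for l
  have "\<exists>g. inj_on g K \<and> g ` K \<subseteq> L \<and> (\<forall>k\<in>K. \<delta> (g k) = \<gamma> k)"
  proof (rule label_preserving_injection_of_iso[where A = ?A and B = ?B and u = "snd u" and v = "snd v",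
        OF R K M'(3) L N'(3)])
    show "snd u \<in> rmod_hom R (rmod_sum K ?A) (rmod_sum L ?B)"
      and "snd v \<in> rmod_hom R (rmod_sum L ?B) (rmod_sum K ?A)"
      using Hom_Morph_cod[OF u] Hom_Morph_cod[OF v] by (simp_all add: sum_Morph_simps(2))
    show "snd v (snd u x) = x" if "x \<in> carrier (rmod_sum K ?A)" for x
      using fun_cong[OF arg_cong[OF vu, of snd], of x] that
      by (simp add: comp_Morph_def id_Morph_def compose_def sum_Morph_simps)
  next
    fix k k' l assume k: "k \<in> K" and k': "k' \<in> K" and l: "l \<in> L" and "\<gamma> k = \<gamma> k'"
      and U: "hom_entry K ?A L ?B (snd u) l k' \<in> rmod_iso R (?A k') (?B l)"
      and V: "hom_entry L ?B K ?A (snd v) k l \<in> rmod_iso R (?B l) (?A k)"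
    moreover have "k' \<in> \<gamma> k'" using k' same_codomain_class_refl[OF M'(1)] by (simp add: \<gamma>_def)
    ultimately have "k' \<in> \<gamma> k" by simp
    then have kk': "same_codomain_class R (M k) (M k')" by (simp add: \<gamma>_def)
    then obtain w where w: "w \<in> Hom_Morph R (M k) (M k')" "snd w \<in> rmod_iso R (?A k) (?A k')"
      unfolding same_codomain_class_def by blast
    obtain u' where u': "u' \<in> Hom_Morph R (M k') (N l)" "snd u' \<in> rmod_iso R (?A k') (?B l)"
      using entry_Hom_Morph[OF R K M'(1) L N'(1) u k' l] U by (metis snd_conv)
    obtain v' where v': "v' \<in> Hom_Morph R (N l) (M k)" "snd v' \<in> rmod_iso R (?B l) (?A k)"
      using entry_Hom_Morph[OF R L N'(1) K M'(1) v l k] V by (metis snd_conv)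
    have "snd (comp_Morph (M k) u' w) \<in> rmod_iso R (?A k) (?B l)"
      using rmod_iso_compose[OF Morph_ModD(2)[OF M'(1)[OF k]] w(2) u'(2)] by (simp add: comp_Morph_def)
    then have kl: "same_codomain_class R (M k) (N l)"
      using comp_Morph_Hom[OF M'(1)[OF k] M'(1)[OF k'] w(1) u'(1)] v'
      unfolding same_codomain_class_def by blast
    then show "\<delta> l = \<gamma> k"
      unfolding \<delta>_def \<gamma>_def using M'(1) N'(1) k l
      by (meson same_codomain_class_sym same_codomain_class_trans)
  qed
  then obtain g where g: "inj_on g K" "g ` K \<subseteq> L" "\<And>k. k \<in> K \<Longrightarrow> \<delta> (g k) = \<gamma> k" by blast
  have "same_codomain_class R (M k) (N (g k))" if k: "k \<in> K" for k
  proof -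
    have "k \<in> \<delta> (g k)" unfolding g(3)[OF k] using k same_codomain_class_refl[OF M'(1)] by (simp add: \<gamma>_def)
    then show ?thesis by (simp add: \<delta>_def same_codomain_class_sym)
  qed
  then show ?thesis using g by blast
qed

end

section \<open>Pairs of matchings\<close>

text \<open>The property of a relation between two families that holds when both are classified by the same
  equivalence classes: \<open>C\<close> is then a disjoint union of rectangles.\<close>
definition difunctional_on :: "'a set \<Rightarrow> ('a \<Rightarrow> 'a \<Rightarrow> bool) \<Rightarrow> bool" where
  "difunctional_on K C \<longleftrightarrow>
     (\<forall>i\<in>K. \<forall>j\<in>K. \<forall>l\<in>K. \<forall>m\<in>K. C i l \<longrightarrow> C j l \<longrightarrow> C j m \<longrightarrow> C i m)"

text \<open>Exchanging the values \<open>\<phi> k\<close> and \<open>\<psi> k\<close> in \<open>\<psi>\<close> makes \<open>\<psi>\<close> agree with \<open>\<phi>\<close> at \<open>k\<close>.  No agreement is lost: neither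
  \<open>k\<close> nor the other index at which \<open>\<psi>\<close> changes is one of agreement.  Difunctionality keeps the changed matching inside \<open>C\<close>.\<close>
lemma improve_agreement:
  assumes K: "finite K" and \<phi>: "\<phi> permutes K" and \<psi>: "\<psi> permutes K"
    and C: "\<And>k. k \<in> K \<Longrightarrow> C k (\<psi> k)"
    and difunctional: "difunctional_on K C"
    and k: "k \<in> K" and neq: "\<psi> k \<noteq> \<phi> k" and Ck: "C k (\<phi> k)"
  shows "\<exists>\<psi>'. \<psi>' permutes K \<and> (\<forall>k\<in>K. C k (\<psi>' k)) \<and>
    card {k \<in> K. \<phi> k = \<psi> k} < card {k \<in> K. \<phi> k = \<psi>' k}"
proof (intro exI conjI ballI)
  let ?\<psi> = "transpose (\<phi> k) (\<psi> k) \<circ> \<psi>"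
  have in_K: "\<phi> j \<in> K" "\<psi> j \<in> K" if "j \<in> K" for j
    using that permutes_in_image[OF \<phi>] permutes_in_image[OF \<psi>] by simp_all
  have inj: "inj \<phi>" "inj \<psi>" using permutes_inj[OF \<phi>] permutes_inj[OF \<psi>] .
  show "?\<psi> permutes K"
    by (intro permutes_compose \<psi> permutes_swap_id in_K k)
  show "C j (?\<psi> j)" if j: "j \<in> K" for j
  proof (cases "j = k")
    case True
    then show ?thesis using Ck by simp
  next
    case False
    then have "\<psi> j \<noteq> \<psi> k" using inj_eq[OF inj(2)] by simp
    show ?thesis
    proof (cases "\<psi> j = \<phi> k")
      case True
      then have "C j (\<psi> k)"
        using difunctional j k in_K[OF k] C[OF j] C[OF k] Ck unfolding difunctional_on_def by metis
      then show ?thesis using True by simp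
    next
      case False
      then show ?thesis using \<open>\<psi> j \<noteq> \<psi> k\<close> C[OF j] by (simp add: transpose_apply_other)
    qed
  qed
  have "{k \<in> K. \<phi> k = \<psi> k} \<subset> {k \<in> K. \<phi> k = ?\<psi> k}"
  proof
    show "{k \<in> K. \<phi> k = \<psi> k} \<subseteq> {k \<in> K. \<phi> k = ?\<psi> k}"
    proof (rule subsetI)
      fix j assume "j \<in> {k \<in> K. \<phi> k = \<psi> k}"
      then have j: "j \<in> K" "\<phi> j = \<psi> j" by simp_all
      then have "j \<noteq> k" using neq by auto
      then have "\<psi> j \<noteq> \<psi> k" using inj_eq[OF inj(2)] by simp
      moreover have "\<psi> j \<noteq> \<phi> k" unfolding j(2)[symmetric] using inj_eq[OF inj(1)] \<open>j \<noteq> k\<close> by simp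
      ultimately show "j \<in> {k \<in> K. \<phi> k = ?\<psi> k}" using j by (simp add: transpose_apply_other)
    qed
    have "k \<in> {k \<in> K. \<phi> k = ?\<psi> k}" "k \<notin> {k \<in> K. \<phi> k = \<psi> k}" using k neq by auto
    then show "{k \<in> K. \<phi> k = \<psi> k} \<noteq> {k \<in> K. \<phi> k = ?\<psi> k}" by blast
  qed
  then show "card {k \<in> K. \<phi> k = \<psi> k} < card {k \<in> K. \<phi> k = ?\<psi> k}"
    using K by (intro psubset_card_mono) auto
qed

text \<open>A pair with the largest number of agreements has the required property, since otherwise an exchange
  would add one.  Applied to the two class relations, the conclusion says that at an index where the matchings differ,
  neither of them joins two objects that share both classes.\<close>
lemma matchings_with_maximal_agreement:
  assumes K: "finite K" and "\<phi> permutes K" "\<psi> permutes K"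
    and "\<And>k. k \<in> K \<Longrightarrow> D k (\<phi> k)" and "\<And>k. k \<in> K \<Longrightarrow> C k (\<psi> k)"
    and D: "difunctional_on K D"
    and C: "difunctional_on K C"
  shows "\<exists>\<phi>' \<psi>'. \<phi>' permutes K \<and> \<psi>' permutes K \<and>
    (\<forall>k\<in>K. D k (\<phi>' k) \<and> C k (\<psi>' k) \<and> (C k (\<phi>' k) \<or> D k (\<psi>' k) \<longrightarrow> \<phi>' k = \<psi>' k))"
proof -
  define P where "P p \<longleftrightarrow> fst p permutes K \<and> snd p permutes K \<and>
    (\<forall>k\<in>K. D k (fst p k) \<and> C k (snd p k))" for p
  define agree where "agree p = card {k \<in> K. fst p k = snd p k}" for p :: "('a \<Rightarrow> 'a) \<times> ('a \<Rightarrow> 'a)"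
  have "P (\<phi>, \<psi>)" using assms by (simp add: P_def)
  moreover have "\<forall>p. P p \<longrightarrow> agree p < Suc (card K)"
    using K by (auto simp: agree_def less_Suc_eq_le intro: card_mono)
  ultimately have "\<exists>p. P p \<and> (\<forall>q. P q \<longrightarrow> agree q \<le> agree p)"
    by (rule ex_has_greatest_nat)
  then obtain p where p: "P p" and max: "\<And>q. P q \<Longrightarrow> agree q \<le> agree p"
    by auto
  have perm: "fst p permutes K" "snd p permutes K" and DC: "\<And>k. k \<in> K \<Longrightarrow> D k (fst p k)"
    "\<And>k. k \<in> K \<Longrightarrow> C k (snd p k)"
    using p by (simp_all add: P_def)
  have agreement: "fst p k = snd p k" if k: "k \<in> K" and CD: "C k (fst p k) \<or> D k (snd p k)" for k
  proof (rule ccontr)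
    assume neq: "fst p k \<noteq> snd p k"
    from CD show False
    proof
      assume Ck: "C k (fst p k)"
      obtain \<psi>' where "\<psi>' permutes K" "\<forall>k\<in>K. C k (\<psi>' k)"
        and less: "agree p < card {k \<in> K. fst p k = \<psi>' k}"
        using improve_agreement[OF K perm DC(2) C k neq[symmetric] Ck] unfolding agree_def by auto
      then have "P (fst p, \<psi>')" using perm DC by (simp add: P_def)
      from max[OF this] less show False by (simp add: agree_def)
    next
      assume Dk: "D k (snd p k)"
      obtain \<phi>' where "\<phi>' permutes K" "\<forall>k\<in>K. D k (\<phi>' k)"
        and less: "card {k \<in> K. snd p k = fst p k} < card {k \<in> K. snd p k = \<phi>' k}"
        using improve_agreement[OF K perm(2,1) DC(1) D k neq Dk] by auto
      then have "P (\<phi>', snd p)" using perm DC by (simp add: P_def)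
      from max[OF this] less show False by (simp add: agree_def eq_commute[of "snd p _"])
    qed
  qed
  show ?thesis
    using perm DC agreement by (intro exI[of _ "fst p"] exI[of _ "snd p"]) simp
qed

lemma permutation_extending_injection:
  assumes "finite K" "inj_on g K" "g ` K \<subseteq> K"
  shows "(\<lambda>k. if k \<in> K then g k else k) permutes K"
proof (rule bij_imp_permutes)
  have "bij_betw g K K" using assms by (simp add: bij_betw_def endo_inj_surj)
  then show "bij_betw (\<lambda>k. if k \<in> K then g k else k) K K"
    by (rule bij_betw_cong[THEN iffD1, rotated]) simp
qed simp

section \<open>The isomorphism criterion\<close>

text \<open>Choose the matchings \<open>\<phi>'\<close>, \<open>\<psi>'\<close> of maximal agreement and a matrix of morphisms whose entry at \<open>(l, k)\<close> is
  invertible on domains exactly for \<open>l = \<phi>' k\<close> and on codomains exactly for \<open>l = \<psi>' k\<close>.  Then both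
  components of the induced morphism are isomorphisms.  Where \<open>\<phi>'\<close> and \<open>\<psi>'\<close> differ, a morphism that is invertible
  on domains cannot be invertible on codomains as well, for it would make the objects share both classes.\<close>
lemma iso_sum_Morph_if_same_classes:
  assumes R: "ring R" and K: "finite K"
    and M: "\<And>k. k \<in> K \<Longrightarrow> M k \<in> Morph_local R" and N: "\<And>k. k \<in> K \<Longrightarrow> N k \<in> Morph_local R"
    and "\<phi> permutes K" "\<psi> permutes K"
    and "\<And>k. k \<in> K \<Longrightarrow> same_domain_class R (M k) (N (\<phi> k))"
    and "\<And>k. k \<in> K \<Longrightarrow> same_codomain_class R (M k) (N (\<psi> k))"
  shows "iso_Morph R (sum_Morph K M) (sum_Morph K N)"
proof -
  note M' = Morph_localD[OF M] and N' = Morph_localD[OF N]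
  let ?D = "\<lambda>k l. same_domain_class R (M k) (N l)" and ?C = "\<lambda>k l. same_codomain_class R (M k) (N l)"
  have "?D i m" if "i \<in> K" "j \<in> K" "l \<in> K" "m \<in> K" "?D i l" "?D j l" "?D j m" for i j l m
  proof -
    have "same_domain_class R (M i) (M j)"
      using same_domain_class_trans[OF M'(1) N'(1) M'(1) that(5) same_domain_class_sym[OF that(6)]] that by simp
    from same_domain_class_trans[OF M'(1) M'(1) N'(1) this that(7)] show ?thesis using that by simp
  qed
  then have D_difunctional: "difunctional_on K ?D" unfolding difunctional_on_def by blast
  have "?C i m" if "i \<in> K" "j \<in> K" "l \<in> K" "m \<in> K" "?C i l" "?C j l" "?C j m" for i j l m
  proof -
    have "same_codomain_class R (M i) (M j)"
      using same_codomain_class_trans[OF M'(1) N'(1) M'(1) that(5) same_codomain_class_sym[OF that(6)]] that by simp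
    from same_codomain_class_trans[OF M'(1) M'(1) N'(1) this that(7)] show ?thesis using that by simp
  qed
  then have C_difunctional: "difunctional_on K ?C" unfolding difunctional_on_def by blast
  have "\<exists>\<phi>' \<psi>'. \<phi>' permutes K \<and> \<psi>' permutes K \<and>
      (\<forall>k\<in>K. ?D k (\<phi>' k) \<and> ?C k (\<psi>' k) \<and> (?C k (\<phi>' k) \<or> ?D k (\<psi>' k) \<longrightarrow> \<phi>' k = \<psi>' k))"
    by (rule matchings_with_maximal_agreement[OF K assms(5-8) D_difunctional C_difunctional])
  then obtain \<phi>' \<psi>' where \<phi>': "\<phi>' permutes K" and \<psi>': "\<psi>' permutes K"
    and D: "\<And>k. k \<in> K \<Longrightarrow> ?D k (\<phi>' k)" and C: "\<And>k. k \<in> K \<Longrightarrow> ?C k (\<psi>' k)"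
    and agree: "\<And>k. \<lbrakk>k \<in> K; ?C k (\<phi>' k) \<or> ?D k (\<psi>' k)\<rbrakk> \<Longrightarrow> \<phi>' k = \<psi>' k"
    by blast
  have entry: "\<exists>w\<in>Hom_Morph R (M k) (N l).
      (fst w \<in> rmod_iso R (Dom (M k)) (Dom (N l)) \<longleftrightarrow> l = \<phi>' k) \<and>
      (snd w \<in> rmod_iso R (Cod (M k)) (Cod (N l)) \<longleftrightarrow> l = \<psi>' k)" if k: "k \<in> K" and l: "l \<in> K" for k l
  proof -
    note Mk = M'[OF k] and Nl = N'[OF l]
    note both = same_classes_if_iso_components[OF Mk(1) Nl(1)]
    consider "l = \<phi>' k" "l = \<psi>' k" | "l = \<phi>' k" "l \<noteq> \<psi>' k" | "l \<noteq> \<phi>' k" "l = \<psi>' k"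
      | "l \<noteq> \<phi>' k" "l \<noteq> \<psi>' k" by blast
    then show ?thesis
    proof cases
      case 1
      then have "?D k l" "?C k l" using D[OF k] C[OF k] by simp_all
      with iso_components_if_same_classes[OF M[OF k] N[OF l]]
      show ?thesis using 1 by simp
    next
      case 2
      obtain d where d: "d \<in> Hom_Morph R (M k) (N l)" "fst d \<in> rmod_iso R (Dom (M k)) (Dom (N l))"
        using D[OF k] 2 unfolding same_domain_class_def by blast
      have "snd d \<notin> rmod_iso R (Cod (M k)) (Cod (N l))"
        using both(2)[OF d] agree[OF k] 2 by blast
      then show ?thesis using d 2 by blast
    next
      case 3
      obtain c where c: "c \<in> Hom_Morph R (M k) (N l)" "snd c \<in> rmod_iso R (Cod (M k)) (Cod (N l))"
        using C[OF k] 3 unfolding same_codomain_class_def by blast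
      have "fst c \<notin> rmod_iso R (Dom (M k)) (Dom (N l))"
        using both(1)[OF c(1) _ c(2)] agree[OF k] 3 by metis
      then show ?thesis using c 3 by blast
    next
      case 4
      then show ?thesis
        using zero_Morph_Hom[OF Mk(1) Nl(1)] hom_zero_not_iso[OF Mk(2), of "Dom (N l)"]
          hom_zero_not_iso[OF Mk(3), of "Cod (N l)"] by force
    qed
  qed
  define w where "w l k = (SOME w. w \<in> Hom_Morph R (M k) (N l) \<and>
      (fst w \<in> rmod_iso R (Dom (M k)) (Dom (N l)) \<longleftrightarrow> l = \<phi>' k) \<and>
      (snd w \<in> rmod_iso R (Cod (M k)) (Cod (N l)) \<longleftrightarrow> l = \<psi>' k))" for l k
  have w: "w l k \<in> Hom_Morph R (M k) (N l)"
    and w\<^sub>0: "fst (w l k) \<in> rmod_iso R (Dom (M k)) (Dom (N l)) \<longleftrightarrow> l = \<phi>' k"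
    and w\<^sub>1: "snd (w l k) \<in> rmod_iso R (Cod (M k)) (Cod (N l)) \<longleftrightarrow> l = \<psi>' k"
    if "k \<in> K" "l \<in> K" for k l
    using someI_ex[OF entry[OF that, unfolded Bex_def]] unfolding w_def by blast+
  let ?u = "(matrix_hom K (\<lambda>k. Dom (M k)) K (\<lambda>l. Dom (N l)) (\<lambda>l k. fst (w l k)),
    matrix_hom K (\<lambda>k. Cod (M k)) K (\<lambda>l. Cod (N l)) (\<lambda>l k. snd (w l k)))"
  show ?thesis
  proof (rule iso_MorphI[where u = ?u])
    show "sum_Morph K M \<in> Morph_Mod R" "sum_Morph K N \<in> Morph_Mod R"
      using sum_Morph_Morph_Mod[OF R K M'(1)] sum_Morph_Morph_Mod[OF R K N'(1)] by simp_all
    show "?u \<in> Hom_Morph R (sum_Morph K M) (sum_Morph K N)"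
      by (rule matrix_Hom_Morph[OF R K M'(1) K N'(1) w])
    have "matrix_hom K (\<lambda>k. Dom (M k)) K (\<lambda>l. Dom (N l)) (\<lambda>l k. fst (w l k))
        \<in> rmod_iso R (rmod_sum K (\<lambda>k. Dom (M k))) (rmod_sum K (\<lambda>l. Dom (N l)))"
      by (rule matrix_hom_iso[OF R K permutes_imp_bij[OF \<phi>'] M'(2) N'(2) Hom_Morph_dom[OF w] w\<^sub>0])
    then show "fst ?u \<in> rmod_iso R (Dom (sum_Morph K M)) (Dom (sum_Morph K N))"
      by (simp add: sum_Morph_simps(1))
    have "matrix_hom K (\<lambda>k. Cod (M k)) K (\<lambda>l. Cod (N l)) (\<lambda>l k. snd (w l k))
        \<in> rmod_iso R (rmod_sum K (\<lambda>k. Cod (M k))) (rmod_sum K (\<lambda>l. Cod (N l)))"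
      by (rule matrix_hom_iso[OF R K permutes_imp_bij[OF \<psi>'] M'(3) N'(3) Hom_Morph_cod[OF w] w\<^sub>1])
    then show "snd ?u \<in> rmod_iso R (Cod (sum_Morph K M)) (Cod (sum_Morph K N))"
      by (simp add: sum_Morph_simps(2))
  qed
qed

theorem theorem6p4:
  fixes R :: "'r ring"
    and M :: "nat \<Rightarrow> ('r, 'a, 'b) mor_obj"
    and N :: "nat \<Rightarrow> ('r, 'c, 'd) mor_obj"
    and r s :: nat
  assumes "ring R" and "\<one>\<^bsub>R\<^esub> \<noteq> \<zero>\<^bsub>R\<^esub>"
    and "\<And>k. k \<in> {1..r} \<Longrightarrow> M k \<in> Morph_local R"
    and "\<And>l. l \<in> {1..s} \<Longrightarrow> N l \<in> Morph_local R"
  shows "iso_Morph R (sum_Morph {1..r} M) (sum_Morph {1..s} N) \<longleftrightarrow>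
    r = s \<and>
    (\<exists>\<phi>\<^sub>d \<phi>\<^sub>c. \<phi>\<^sub>d permutes {1..r} \<and> \<phi>\<^sub>c permutes {1..r} \<and>
      (\<forall>k\<in>{1..r}. same_domain_class R (M k) (N (\<phi>\<^sub>d k)) \<and>
                   same_codomain_class R (M k) (N (\<phi>\<^sub>c k))))"
proof (intro iffI; (elim conjE exE)?)
  assume iso: "iso_Morph R (sum_Morph {1..r} M) (sum_Morph {1..s} N)"
  note facts = assms(1) finite_atLeastAtMost finite_atLeastAtMost
  obtain d where d: "inj_on d {1..r}" "d ` {1..r} \<subseteq> {1..s}"
    "\<And>k. k \<in> {1..r} \<Longrightarrow> same_domain_class R (M k) (N (d k))"
    using domain_class_preserving_injection[OF facts assms(3,4) iso] by auto
  obtain c where c: "inj_on c {1..r}" "c ` {1..r} \<subseteq> {1..s}"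
    "\<And>k. k \<in> {1..r} \<Longrightarrow> same_codomain_class R (M k) (N (c k))"
    using codomain_class_preserving_injection[OF facts assms(3,4) iso] by auto
  obtain e where e: "inj_on e {1..s}" "e ` {1..s} \<subseteq> {1..r}"
    using domain_class_preserving_injection[OF facts assms(4,3) iso_Morph_sym[OF iso]] by auto
  have "r = s"
    using card_inj_on_le[OF d(1,2)] card_inj_on_le[OF e(1,2)] by simp
  moreover have "(\<lambda>k. if k \<in> {1..r} then d k else k) permutes {1..r}"
    "(\<lambda>k. if k \<in> {1..r} then c k else k) permutes {1..r}"
    using permutation_extending_injection[OF _ d(1)] permutation_extending_injection[OF _ c(1)] d(2) c(2)
      \<open>r = s\<close> by simp_all
  ultimately show "r = s \<and>
    (\<exists>\<phi>\<^sub>d \<phi>\<^sub>c. \<phi>\<^sub>d permutes {1..r} \<and> \<phi>\<^sub>c permutes {1..r} \<and>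
      (\<forall>k\<in>{1..r}. same_domain_class R (M k) (N (\<phi>\<^sub>d k)) \<and>
                   same_codomain_class R (M k) (N (\<phi>\<^sub>c k))))"
    using d(3) c(3)
    by (intro conjI exI[of _ "\<lambda>k. if k \<in> {1..r} then d k else k"]
        exI[of _ "\<lambda>k. if k \<in> {1..r} then c k else k"]) auto
next
  fix \<phi>\<^sub>d \<phi>\<^sub>c
  assume "r = s" and perm: "\<phi>\<^sub>d permutes {1..r}" "\<phi>\<^sub>c permutes {1..r}"
    and classes: "\<forall>k\<in>{1..r}. same_domain_class R (M k) (N (\<phi>\<^sub>d k)) \<and> same_codomain_class R (M k) (N (\<phi>\<^sub>c k))"
  then show "iso_Morph R (sum_Morph {1..r} M) (sum_Morph {1..s} N)"
    using iso_sum_Morph_if_same_classes[OF assms(1) finite_atLeastAtMost assms(3) assms(4) perm] by simp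
qed

end
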